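(* Let $n\ge 2$ be an integer, $k,c_b>0$, $\rho_0>0$, and let $\lambda_{1,0},\dots,\lambda_{n,0}$ be real numbers with $\lambda_{1,0}=\cdots=\lambda_{J,0}<\lambda_{J+1,0}\le\cdots\le\lambda_{n,0}$ for some integer $1\le J\le n$. Consider the system $$\lambda_i'=-\lambda_i^2+\frac{k}{n}(\rho-c_b)\ (i=1,\dots,n),\qquad \rho'=-\rho\lambda,\quad \lambda=\sum_{i=1}^n\lambda_i,\qquad \rho(0)=\rho_0,\ \lambda_i(0)=\lambda_{i,0},$$ suppose its maximal interval of existence is $[0,t_B)$ with $0<t_B<\infty$, and let $u_i(t)=e^{\int_0^t\lambda_i(s)\,ds}$. If $J<j\le n$, then there exist constants $0\le q_j\le p_j$ such that $\lim_{t\to t_B^-}u_1'(t)u_j(t)=-p_j$ and $\lim_{t\to t_B^-}u_1(t)u_j'(t)=q_j$.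
   Context: Solutions are real-valued and continuously differentiable on $[0,t_B)$. *)

theory Defs
  imports "HOL-Analysis.Analysis"
begin

definition is_solution ::
  "nat \<Rightarrow> real \<Rightarrow> real \<Rightarrow> real \<Rightarrow> (nat \<Rightarrow> real) \<Rightarrow> real
    \<Rightarrow> (nat \<Rightarrow> real \<Rightarrow> real) \<Rightarrow> (real \<Rightarrow> real) \<Rightarrow> bool" where
  "is_solution n k cb rho0 lam0 T lam rho \<longleftrightarrow>
     0 < T \<and> rho 0 = rho0 \<and> (\<forall>i\<in>{1..n}. lam i 0 = lam0 i) \<and>
     (\<forall>t\<in>{0..<T}.
        (\<forall>i\<in>{1..n}. (lam i has_real_derivative
              (- ((lam i t) ^ 2) + k / real n * (rho t - cb))) (at t within {0..<T})) \<and>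
        (rho has_real_derivative (- rho t * (\<Sum>i=1..n. lam i t))) (at t within {0..<T}))"

definition maximal_solution ::
  "nat \<Rightarrow> real \<Rightarrow> real \<Rightarrow> real \<Rightarrow> (nat \<Rightarrow> real) \<Rightarrow> real
    \<Rightarrow> (nat \<Rightarrow> real \<Rightarrow> real) \<Rightarrow> (real \<Rightarrow> real) \<Rightarrow> bool" where
  "maximal_solution n k cb rho0 lam0 tB lam rho \<longleftrightarrow>
     is_solution n k cb rho0 lam0 tB lam rho \<and>
     (\<nexists>T lam' rho'. T > tB \<and> is_solution n k cb rho0 lam0 T lam' rho' \<and>
        (\<forall>t\<in>{0..<tB}. rho' t = rho t \<and> (\<forall>i\<in>{1..n}. lam' i t = lam i t)))"

definition u_fun :: "(nat \<Rightarrow> real \<Rightarrow> real) \<Rightarrow> nat \<Rightarrow> real \<Rightarrow> real" where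
  "u_fun lam i t = exp (integral {0..t} (lam i))"

end

theory Submission
  imports Defs
begin

text \<open>
  The functions \<open>u i\<close> all solve the linear equation \<open>u'' = \<kappa> * (rho - cb) * u\<close> with
  \<open>\<kappa> = k / n\<close>, and \<open>rho = rho0 / (\<Prod>i. u i)\<close>. Hence the Wronskian of \<open>u 1\<close> and \<open>u j\<close> is the constant
  \<open>w = lam0 j - lam0 1 > 0\<close>, so only \<open>\<beta> = - u 1' * u j\<close> has to be shown to converge, to a limit in
  \<open>[w / 2, w]\<close>. Maximality forces \<open>u 1 \<longlongrightarrow> 0\<close>. Dividing the \<open>u i\<close> by a positive solution \<open>\<phi>\<close> of
  \<open>\<phi>'' = - \<kappa> * cb * \<phi>\<close> makes them convex, which gives \<open>\<beta> \<ge> 0\<close>. If \<open>u j\<close> does not eventually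
  increase, then \<open>\<beta> \<longlongrightarrow> w\<close>. Otherwise \<open>0 \<le> \<beta> \<le> w\<close>, and in the time \<open>ds = dt / (u 1 * u j)\<close>,
  which runs to infinity, \<open>\<beta>' = \<beta> * (w - \<beta>) - F\<close> with
  \<open>F = \<kappa> * rho * (u 1 * u j)\<^sup>2\<close>. All \<open>u i\<close> are combinations of \<open>u 1\<close> and \<open>u j\<close>, so for
  \<open>j = J + 1\<close> the function \<open>F\<close> behaves like \<open>u 1 ^ (2 - J) * u j ^ (2 - (n - J))\<close>. If \<open>J \<le> 2\<close> then
  \<open>F\<close> has a limit, if \<open>J \<ge> 3\<close> and \<open>n \<le> 2 * J\<close> then \<open>F \<longlongrightarrow> \<infinity>\<close>, which is impossible, and in the
  remaining case \<open>(\<beta>, F)\<close> is an asymptotically autonomous planar system with a Lyapunov function.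
  Finally \<open>u 1 * u j \<longlongrightarrow> 0\<close> has derivative close to \<open>w - 2 * \<beta>\<close>, so the limit of \<open>\<beta>\<close> is at least
  \<open>w / 2\<close>.
\<close>

section \<open>Monotonicity, limits and level crossings\<close>

lemma mono_tendsto_at_left:
  fixes f :: "real \<Rightarrow> real"
  assumes "a < b" and mono: "\<And>x y. a \<le> x \<Longrightarrow> x \<le> y \<Longrightarrow> y < b \<Longrightarrow> f x \<le> f y"
    and bdd: "\<And>x. a \<le> x \<Longrightarrow> x < b \<Longrightarrow> f x \<le> B"
  shows "\<exists>L. (f \<longlongrightarrow> L) (at_left b) \<and> (\<forall>x\<in>{a..<b}. f x \<le> L)"
proof -
  define L where "L = Sup (f ` {a..<b})"
  have bdd': "bdd_above (f ` {a..<b})"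
    using bdd by (auto intro!: bdd_aboveI[where M = B])
  have le: "f x \<le> L" if "x \<in> {a..<b}" for x
    unfolding L_def using that bdd' by (intro cSup_upper) auto
  have "(f \<longlongrightarrow> L) (at_left b)"
  proof (rule increasing_tendsto)
    show "\<forall>\<^sub>F x in at_left b. f x \<le> L"
      using eventually_at_left_real[OF \<open>a < b\<close>] by eventually_elim (auto intro: le)
    fix y assume "y < L"
    then obtain x where x: "x \<in> {a..<b}" "y < f x"
      unfolding L_def using less_cSup_iff[OF _ bdd', of y] \<open>a < b\<close> by auto
    then have "x < b" by auto
    show "\<forall>\<^sub>F x in at_left b. y < f x"
      using eventually_at_left_real[OF \<open>x < b\<close>]
      by eventually_elim (use x in \<open>auto intro: less_le_trans[OF _ mono]\<close>)
  qed
  then show ?thesis using le by blast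
qed

lemma antimono_tendsto_at_left:
  fixes f :: "real \<Rightarrow> real"
  assumes "a < b" and mono: "\<And>x y. a \<le> x \<Longrightarrow> x \<le> y \<Longrightarrow> y < b \<Longrightarrow> f y \<le> f x"
    and bdd: "\<And>x. a \<le> x \<Longrightarrow> x < b \<Longrightarrow> B \<le> f x"
  shows "\<exists>L. (f \<longlongrightarrow> L) (at_left b) \<and> (\<forall>x\<in>{a..<b}. L \<le> f x)"
proof -
  obtain L where L: "((\<lambda>x. - f x) \<longlongrightarrow> L) (at_left b)" "\<forall>x\<in>{a..<b}. - f x \<le> L"
    using mono_tendsto_at_left[of a b "\<lambda>x. - f x" "- B"] assms by auto
  have "(f \<longlongrightarrow> - L) (at_left b)" using tendsto_minus[OF L(1)] by simp
  moreover have "\<forall>x\<in>{a..<b}. - L \<le> f x" using L(2) by force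
  ultimately show ?thesis by blast
qed

lemma mono_at_left_cases:
  fixes f :: "real \<Rightarrow> real"
  assumes "a < b" and mono: "\<And>x y. a \<le> x \<Longrightarrow> x \<le> y \<Longrightarrow> y < b \<Longrightarrow> f x \<le> f y"
  shows "(\<exists>L. (f \<longlongrightarrow> L) (at_left b)) \<or> filterlim f at_top (at_left b)"
proof (cases "\<exists>B. \<forall>x\<in>{a..<b}. f x \<le> B")
  case True
  then obtain B where B: "\<forall>x\<in>{a..<b}. f x \<le> B" by blast
  have "\<exists>L. (f \<longlongrightarrow> L) (at_left b) \<and> (\<forall>x\<in>{a..<b}. f x \<le> L)"
    by (rule mono_tendsto_at_left[of a b f B]) (use assms B in auto)
  then show ?thesis by blast
next
  case False
  have "filterlim f at_top (at_left b)"
    unfolding filterlim_at_top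
  proof
    fix Z
    from False obtain x where x: "a \<le> x" "x < b" "Z < f x"
      by (meson atLeastLessThan_iff not_le)
    show "\<forall>\<^sub>F x in at_left b. Z \<le> f x"
      using eventually_at_left_real[OF \<open>x < b\<close>]
      by eventually_elim (use x in \<open>auto intro: order_trans[OF less_imp_le mono]\<close>)
  qed
  then show ?thesis by blast
qed

lemma diff_le_deriv_bound:
  fixes f :: "real \<Rightarrow> real"
  assumes "x \<le> y"
    and der: "\<And>t. x \<le> t \<Longrightarrow> t \<le> y \<Longrightarrow> (f has_real_derivative f' t) (at t within {x..y})"
    and le: "\<And>t. x \<le> t \<Longrightarrow> t \<le> y \<Longrightarrow> f' t \<le> C"
  shows "f y - f x \<le> C * (y - x)"
proof (cases "x = y")
  case False
  then have "x < y" using assms by simp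
  obtain z where z: "z \<in> {x<..<y}" "f y - f x = f' z * (y - x)"
    using mvt_simple[OF \<open>x < y\<close>, of f "\<lambda>t. (*) (f' t)"] der
    by (auto simp: has_field_derivative_def)
  then show ?thesis using le[of z] \<open>x < y\<close> by (auto intro!: mult_right_mono)
qed simp

lemma diff_ge_deriv_bound:
  fixes f :: "real \<Rightarrow> real"
  assumes "x \<le> y"
    and der: "\<And>t. x \<le> t \<Longrightarrow> t \<le> y \<Longrightarrow> (f has_real_derivative f' t) (at t within {x..y})"
    and ge: "\<And>t. x \<le> t \<Longrightarrow> t \<le> y \<Longrightarrow> C \<le> f' t"
  shows "C * (y - x) \<le> f y - f x"
proof -
  have "(- f y) - (- f x) \<le> (- C) * (y - x)"
    by (rule diff_le_deriv_bound[where f' = "\<lambda>t. - f' t"])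
      (use assms in \<open>auto intro!: derivative_eq_intros\<close>)
  then show ?thesis by simp
qed

text \<open>Adding \<open>C * x\<close> to a function with derivative at least \<open>- C\<close>
  makes it nondecreasing, and on a bounded interval it stays bounded, so the monotone case
  applies.\<close>

lemma bounded_deriv_tendsto_at_left:
  fixes f :: "real \<Rightarrow> real"
  assumes "a < b"
    and der: "\<And>t. a \<le> t \<Longrightarrow> t < b \<Longrightarrow> (f has_real_derivative f' t) (at t within {a..<b})"
    and bd: "\<And>t. a \<le> t \<Longrightarrow> t < b \<Longrightarrow> \<bar>f' t\<bar> \<le> C"
  shows "\<exists>L. (f \<longlongrightarrow> L) (at_left b)"
proof -
  have der': "(f has_real_derivative f' t) (at t within {x..y})"
    if "a \<le> x" "y < b" "x \<le> t" "t \<le> y" for t x y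
    using that by (intro DERIV_subset[OF der]) auto
  have C0: "0 \<le> C" using bd[of a] \<open>a < b\<close> by force
  have bd': "- C \<le> f' t" "f' t \<le> C" if "a \<le> t" "t < b" for t
    using bd[OF that] by auto
  have up: "f y - f x \<le> C * (y - x)" if "a \<le> x" "x \<le> y" "y < b" for x y
    by (rule diff_le_deriv_bound[where f' = f']) (use that in \<open>auto intro: der' bd'\<close>)
  have lo: "(- C) * (y - x) \<le> f y - f x" if "a \<le> x" "x \<le> y" "y < b" for x y
    by (rule diff_ge_deriv_bound[where f' = f']) (use that in \<open>auto intro: der' bd'\<close>)
  have "\<exists>L. ((\<lambda>x. f x + C * x) \<longlongrightarrow> L) (at_left b) \<and> (\<forall>x\<in>{a..<b}. f x + C * x \<le> L)"
  proof (rule mono_tendsto_at_left[OF \<open>a < b\<close>, where B = "f a + C * (b - a) + C * b"])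
    show "f x + C * x \<le> f y + C * y" if "a \<le> x" "x \<le> y" "y < b" for x y
      using lo[OF that] by (simp add: algebra_simps)
    show "f x + C * x \<le> f a + C * (b - a) + C * b" if "a \<le> x" "x < b" for x
    proof -
      have "f x - f a \<le> C * (x - a)" using up[of a x] that by simp
      also have "\<dots> \<le> C * (b - a)" using that C0 by (intro mult_left_mono) auto
      finally show ?thesis using mult_left_mono[of x b C] that C0 by linarith
    qed
  qed
  then obtain L where "((\<lambda>x. f x + C * x) \<longlongrightarrow> L) (at_left b)" by blast
  then have "((\<lambda>x. (f x + C * x) - C * x) \<longlongrightarrow> L - C * b) (at_left b)"
    by (intro tendsto_intros) 
  then show ?thesis by auto
qed

text \<open>The sign condition concerns only times at which the level is attained. At the last time
  up to \<open>s\<close> with \<open>f \<ge> c\<close> the value is exactly \<open>c\<close>, and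
  the positive derivative carries \<open>f\<close> above \<open>c\<close> a little later.\<close>

lemma stays_above_level:
  fixes f :: "real \<Rightarrow> real"
  assumes der: "\<And>s. s0 \<le> s \<Longrightarrow> (f has_real_derivative f' s) (at s)"
    and pos: "\<And>s. s0 \<le> s \<Longrightarrow> f s = c \<Longrightarrow> 0 < f' s"
    and "c \<le> f s0" "s0 \<le> s"
  shows "c \<le> f s"
proof (rule ccontr)
  assume "\<not> c \<le> f s"
  have cont: "continuous_on {s0..s} f"
    by (intro continuous_at_imp_continuous_on ballI DERIV_isCont[OF der]) auto
  define A where "A = {s0..s} \<inter> f -` {c..}"
  have "compact A"
    unfolding A_def compact_eq_bounded_closed
    using continuous_closed_preimage[OF cont]
    by (auto intro: bounded_subset[OF bounded_closed_interval])
  moreover have "s0 \<in> A" using assms by (auto simp: A_def)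
  ultimately obtain r where r: "r \<in> A" "\<And>x. x \<in> A \<Longrightarrow> x \<le> r"
    using compact_attains_sup[of A] by blast
  have rs: "s0 \<le> r" "r < s" "c \<le> f r"
    using r(1) \<open>\<not> c \<le> f s\<close> by (auto simp: A_def less_le)
  have "f r = c"
  proof (rule ccontr)
    assume "f r \<noteq> c"
    obtain x where "r \<le> x" "x \<le> s" "f x = c"
      using IVT2'[of f s c r] rs \<open>\<not> c \<le> f s\<close> continuous_on_subset[OF cont, of "{r..s}"] by force
    then show False using r(2)[of x] rs \<open>f r \<noteq> c\<close> by (auto simp: A_def)
  qed
  then obtain d where d: "0 < d" "\<And>h. 0 < h \<Longrightarrow> h < d \<Longrightarrow> f r < f (r + h)"
    using DERIV_pos_inc_right[OF der pos] rs by blast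
  define h where "h = min (d / 2) (s - r)"
  have "0 < h" "h < d" "h \<le> s - r" using d rs by (auto simp: h_def)
  then have "r + h \<in> A" using d(2)[of h] rs by (auto simp: A_def)
  then show False using r(2) \<open>0 < h\<close> by fastforce
qed

text \<open>A bounded function that crosses every level outside a finite set in only one direction
  at late times cannot oscillate.\<close>

lemma transversal_convergent:
  fixes f :: "real \<Rightarrow> real"
  assumes der: "\<And>s. s0 \<le> s \<Longrightarrow> (f has_real_derivative f' s) (at s)"
    and bnd: "\<And>s. s0 \<le> s \<Longrightarrow> A \<le> f s \<and> f s \<le> B"
    and "finite Z"
    and trans: "\<And>c. c \<notin> Z \<Longrightarrow> A < c \<Longrightarrow> c < B \<Longrightarrow>
      (\<forall>\<^sub>F s in at_top. f s = c \<longrightarrow> 0 < f' s) \<or> (\<forall>\<^sub>F s in at_top. f s = c \<longrightarrow> f' s < 0)"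
  shows "\<exists>L. (f \<longlongrightarrow> L) at_top \<and> A \<le> L \<and> L \<le> B"
proof -
  have evb: "\<forall>\<^sub>F s in at_top. A \<le> f s \<and> f s \<le> B"
    using eventually_ge_at_top[of s0] by eventually_elim (rule bnd)
  have dich: "(\<forall>\<^sub>F s in at_top. c \<le> f s) \<or> (\<forall>\<^sub>F s in at_top. f s \<le> c)" if c: "c \<notin> Z" for c
  proof -
    consider "c \<le> A" | "B \<le> c" | "A < c" "c < B" by linarith
    then show ?thesis
    proof cases
      case 1
      with evb have "\<forall>\<^sub>F s in at_top. c \<le> f s" by (auto elim!: eventually_mono)
      then show ?thesis ..
    next
      case 2
      with evb have "\<forall>\<^sub>F s in at_top. f s \<le> c" by (auto elim!: eventually_mono)
      then show ?thesis ..
    next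
      case 3
      then consider "\<forall>\<^sub>F s in at_top. f s = c \<longrightarrow> 0 < f' s" | "\<forall>\<^sub>F s in at_top. f s = c \<longrightarrow> f' s < 0"
        using trans[OF c] by blast
      then show ?thesis
      proof cases
        case 1
        then obtain s1 where s1: "\<And>s. s1 \<le> s \<Longrightarrow> f s = c \<Longrightarrow> 0 < f' s"
          by (auto simp: eventually_at_top_linorder)
        show ?thesis
        proof (cases "\<exists>s2 \<ge> max s0 s1. c \<le> f s2")
          case True
          then obtain s2 where "s2 \<ge> max s0 s1" "c \<le> f s2" by blast
          then have "c \<le> f s" if "s2 \<le> s" for s
            using that s1 der by (intro stays_above_level[of s2 f f' c s]) auto
          then show ?thesis by (auto simp: eventually_at_top_linorder)
        next
          case False
          then have "\<forall>s\<ge>max s0 s1. f s \<le> c" by (meson linear)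
          then show ?thesis unfolding eventually_at_top_linorder by blast
        qed
      next
        case 2
        then obtain s1 where s1: "\<And>s. s1 \<le> s \<Longrightarrow> f s = c \<Longrightarrow> f' s < 0"
          by (auto simp: eventually_at_top_linorder)
        show ?thesis
        proof (cases "\<exists>s2 \<ge> max s0 s1. f s2 \<le> c")
          case True
          then obtain s2 where "s2 \<ge> max s0 s1" "f s2 \<le> c" by blast
          then have "- c \<le> - f s" if "s2 \<le> s" for s
            using that s1 der
            by (intro stays_above_level[of s2 "\<lambda>s. - f s" "\<lambda>s. - f' s" "- c" s])
              (auto intro!: derivative_eq_intros)
          then show ?thesis by (auto simp: eventually_at_top_linorder)
        next
          case False
          then have "\<forall>s\<ge>max s0 s1. c \<le> f s" by (meson linear)
          then show ?thesis unfolding eventually_at_top_linorder by blast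
        qed
      qed
    qed
  qed
  \<comment> \<open>The supremum of the levels that \<open>f\<close> eventually stays above is its
    lower limit. A larger level outside \<open>Z\<close> is, by \<open>dich\<close>, one that
    \<open>f\<close> eventually stays below.\<close>
  define S where "S = {c. \<forall>\<^sub>F s in at_top. c \<le> f s}"
  define L where "L = Sup S"
  have AS: "A \<in> S" unfolding S_def using evb by (auto elim: eventually_mono)
  have leB: "c \<le> B" if "c \<in> S" for c
  proof -
    have "\<forall>\<^sub>F s in at_top. c \<le> f s" using that by (simp add: S_def)
    from eventually_happens'[OF _ eventually_conj[OF this evb]] show ?thesis by auto
  qed
  then have bdd: "bdd_above S" by (auto simp: bdd_above_def)
  have "(f \<longlongrightarrow> L) at_top"
  proof (rule order_tendstoI)
    fix y assume "y < L"
    then obtain c where "c \<in> S" "y < c"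
      unfolding L_def using less_cSup_iff[OF _ bdd, of y] AS by auto
    then show "\<forall>\<^sub>F s in at_top. y < f s" by (auto simp: S_def elim!: eventually_mono)
  next
    fix y assume "L < y"
    then have "infinite ({L<..<y} - Z)" using \<open>finite Z\<close> by (simp add: infinite_Ioo)
    then have "{L<..<y} - Z \<noteq> {}" by (rule infinite_imp_nonempty)
    then obtain c where "c \<in> {L<..<y} - Z" by blast
    then have c: "L < c" "c < y" "c \<notin> Z" by auto
    have "c \<notin> S" using c cSup_upper[OF _ bdd, of c] by (auto simp: L_def)
    with dich[OF c(3)] have "\<forall>\<^sub>F s in at_top. f s \<le> c" by (auto simp: S_def)
    then show "\<forall>\<^sub>F s in at_top. f s < y" by eventually_elim (use c in auto)
  qed
  moreover have "A \<le> L" unfolding L_def using AS bdd by (rule cSup_upper)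
  moreover have "L \<le> B" unfolding L_def using AS leB by (intro cSup_least) auto
  ultimately show ?thesis by blast
qed

text \<open>\<open>\<Lambda>\<close> is nondecreasing and bounded, so its late increments are small,
  whereas the bound on \<open>f'\<close> makes every value \<open>f s \<ge> e\<close> last long
  enough to force a fixed increment. Domination by \<open>\<Lambda>'\<close> replaces integrability
  of \<open>f\<close>.\<close>

lemma barbalat:
  fixes f \<Lambda> :: "real \<Rightarrow> real"
  assumes derf: "\<And>s. s0 \<le> s \<Longrightarrow> (f has_real_derivative f' s) (at s)"
    and f': "\<And>s. s0 \<le> s \<Longrightarrow> \<bar>f' s\<bar> \<le> C"
    and f0: "\<And>s. s0 \<le> s \<Longrightarrow> 0 \<le> f s"
    and der\<Lambda>: "\<And>s. s0 \<le> s \<Longrightarrow> (\<Lambda> has_real_derivative \<Lambda>' s) (at s)"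
    and \<Lambda>': "\<And>s. s0 \<le> s \<Longrightarrow> f s \<le> \<Lambda>' s"
    and \<Lambda>: "\<And>s. s0 \<le> s \<Longrightarrow> \<Lambda> s \<le> B"
  shows "(f \<longlongrightarrow> 0) at_top"
proof -
  have mono: "\<Lambda> x \<le> \<Lambda> y" if "s0 \<le> x" "x \<le> y" for x y
  proof -
    have "0 * (y - x) \<le> \<Lambda> y - \<Lambda> x"
      by (rule diff_ge_deriv_bound[where f' = \<Lambda>'])
        (use that in \<open>auto intro: has_field_derivative_at_within[OF der\<Lambda>] order_trans[OF f0 \<Lambda>']\<close>)
    then show ?thesis by simp
  qed
  have C0: "0 \<le> C" using f'[of s0] by force
  define L where "L = Sup (\<Lambda> ` {s0..})"
  have bdd: "bdd_above (\<Lambda> ` {s0..})" using \<Lambda> by (auto intro!: bdd_aboveI)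
  show ?thesis
  proof (rule order_tendstoI)
    fix a :: real assume "a < 0"
    show "\<forall>\<^sub>F s in at_top. a < f s"
      using eventually_ge_at_top[of s0] by eventually_elim (use f0 \<open>a < 0\<close> in force)
  next
    fix e :: real assume "0 < e"
    \<comment> \<open>During time \<open>h\<close> the function falls by at most
      \<open>e / 2\<close>, so a value of at least \<open>e\<close> makes \<open>\<Lambda>\<close>
      grow by \<open>h * e / 2\<close>. After \<open>s1\<close> less than \<open>h * e / 4\<close>
      is left.\<close>
    define h where "h = e / (2 * (C + 1))"
    have h: "0 < h" "C * h \<le> e / 2" using \<open>0 < e\<close> C0 by (auto simp: h_def field_simps)
    have "L - h * e / 4 < L" using h \<open>0 < e\<close> by simp
    then obtain s1 where s1: "s0 \<le> s1" "L - h * e / 4 < \<Lambda> s1"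
      unfolding L_def using less_cSup_iff[OF _ bdd] by auto
    have "f s < e" if "s1 \<le> s" for s
    proof (rule ccontr)
      assume "\<not> f s < e"
      have f2: "e / 2 \<le> f x" if "s \<le> x" "x \<le> s + h" for x
      proof -
        have "(- C) * (x - s) \<le> f x - f s"
        proof (rule diff_ge_deriv_bound[where f' = f'])
          show "- C \<le> f' t" if "s \<le> t" for t
            using f'[of t] s1 \<open>s1 \<le> s\<close> that by (auto simp: abs_le_iff)
        qed (use that \<open>s1 \<le> s\<close> s1 in \<open>auto intro: has_field_derivative_at_within[OF derf]\<close>)
        moreover have "C * (x - s) \<le> C * h" using that C0 by (intro mult_left_mono) auto
        ultimately show ?thesis using h \<open>\<not> f s < e\<close> by auto
      qed
      have "e / 2 * (s + h - s) \<le> \<Lambda> (s + h) - \<Lambda> s"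
      proof (rule diff_ge_deriv_bound[where f' = \<Lambda>'])
        show "e / 2 \<le> \<Lambda>' t" if "s \<le> t" "t \<le> s + h" for t
          using f2[OF that] \<Lambda>'[of t] s1 \<open>s1 \<le> s\<close> that by linarith
      qed (use h s1 \<open>s1 \<le> s\<close> in \<open>auto intro: has_field_derivative_at_within[OF der\<Lambda>]\<close>)
      moreover have "\<Lambda> (s + h) \<le> L"
        unfolding L_def using bdd h s1 \<open>s1 \<le> s\<close> by (intro cSup_upper) auto
      moreover have "\<Lambda> s1 \<le> \<Lambda> s" using mono s1 \<open>s1 \<le> s\<close> by blast
      moreover have "0 < h * e" using h \<open>0 < e\<close> by simp
      ultimately show False using s1(2) by (simp add: algebra_simps)
    qed
    then show "\<forall>\<^sub>F s in at_top. f s < e" by (auto simp: eventually_at_top_linorder)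
  qed
qed

section \<open>The forced logistic equation\<close>

text \<open>On the level \<open>\<beta> = c\<close> the derivative is
  \<open>c * (w - c) - F s\<close>, which tends to \<open>c * (w - c) - F0\<close>. Its late sign is
  fixed except at the at most two roots of this quadratic in \<open>c\<close>, which form the
  exceptional set.\<close>

lemma forced_logistic_convergent:
  fixes \<beta> F :: "real \<Rightarrow> real"
  assumes der: "\<And>s. s0 \<le> s \<Longrightarrow> (\<beta> has_real_derivative \<beta> s * (w - \<beta> s) - F s) (at s)"
    and bnd: "\<And>s. s0 \<le> s \<Longrightarrow> 0 \<le> \<beta> s \<and> \<beta> s \<le> w"
    and F: "(F \<longlongrightarrow> F0) at_top"
  shows "\<exists>L. (\<beta> \<longlongrightarrow> L) at_top \<and> 0 \<le> L \<and> L \<le> w"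
proof (rule transversal_convergent[OF der bnd])
  let ?Z = "{c. c * (w - c) = F0}"
  show "finite ?Z"
  proof (cases "?Z = {}")
    case False
    then obtain r where r: "r * (w - r) = F0" by auto
    have "?Z \<subseteq> {r, w - r}"
    proof
      fix c assume "c \<in> ?Z"
      then have "(c - r) * (w - c - r) = 0" using r by (simp add: algebra_simps)
      then show "c \<in> {r, w - r}" by auto
    qed
    then show ?thesis by (rule finite_subset) simp
  qed simp
  fix c assume "c \<notin> ?Z"
  then consider "F0 < c * (w - c)" | "c * (w - c) < F0" by force
  then show "(\<forall>\<^sub>F s in at_top. \<beta> s = c \<longrightarrow> 0 < \<beta> s * (w - \<beta> s) - F s) \<or>
    (\<forall>\<^sub>F s in at_top. \<beta> s = c \<longrightarrow> \<beta> s * (w - \<beta> s) - F s < 0)"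
  proof cases
    case 1
    have "\<forall>\<^sub>F s in at_top. \<beta> s = c \<longrightarrow> 0 < \<beta> s * (w - \<beta> s) - F s"
      using order_tendstoD(2)[OF F 1] by (auto elim!: eventually_mono)
    then show ?thesis ..
  next
    case 2
    have "\<forall>\<^sub>F s in at_top. \<beta> s = c \<longrightarrow> \<beta> s * (w - \<beta> s) - F s < 0"
      using order_tendstoD(1)[OF F 2] by (auto elim!: eventually_mono)
    then show ?thesis ..
  qed
qed

text \<open>The logistic term never exceeds \<open>w * w\<close>, so a large forcing makes the
  derivative at most -1, and \<open>\<beta>\<close> would leave \<open>[0, w]\<close> within time
  \<open>w + 1\<close>.\<close>

lemma forced_logistic_not_at_top:
  fixes \<beta> F :: "real \<Rightarrow> real"
  assumes der: "\<And>s. s0 \<le> s \<Longrightarrow> (\<beta> has_real_derivative \<beta> s * (w - \<beta> s) - F s) (at s)"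
    and bnd: "\<And>s. s0 \<le> s \<Longrightarrow> 0 \<le> \<beta> s \<and> \<beta> s \<le> w"
  shows "\<not> filterlim F at_top at_top"
proof
  assume "filterlim F at_top at_top"
  then have "\<forall>\<^sub>F s in at_top. w * w + 1 \<le> F s" by (simp add: filterlim_at_top)
  then obtain s1 where s1: "\<And>s. s1 \<le> s \<Longrightarrow> w * w + 1 \<le> F s"
    by (auto simp: eventually_at_top_linorder)
  define r where "r = max s0 s1"
  have w0: "0 \<le> w" using bnd[of s0] by simp
  have "\<beta> (r + (w + 1)) - \<beta> r \<le> (- 1) * (r + (w + 1) - r)"
  proof (rule diff_le_deriv_bound)
    show "(\<beta> has_real_derivative \<beta> t * (w - \<beta> t) - F t) (at t within {r..r + (w + 1)})"
      if "r \<le> t" for t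
      using that by (intro has_field_derivative_at_within[OF der]) (auto simp: r_def)
    show "\<beta> t * (w - \<beta> t) - F t \<le> - 1" if "r \<le> t" for t
    proof -
      have "\<beta> t * (w - \<beta> t) \<le> w * w"
        using bnd[of t] that w0 by (intro mult_mono) (auto simp: r_def)
      then show ?thesis using s1[of t] that by (auto simp: r_def)
    qed
  qed (use w0 in auto)
  moreover have "\<beta> r \<le> w" "0 \<le> \<beta> (r + (w + 1))"
    using bnd[of r] bnd[of "r + (w + 1)"] w0 by (auto simp: r_def)
  ultimately show False by simp
qed

text \<open>Up to the decreasing factor \<open>\<theta>\<close> this is an autonomous planar system of Lotka--Volterra type
  with equilibrium \<open>\<beta> = b\<close>. The Lyapunov function \<open>\<Lambda>\<close> below is the first integral of the
  conservative case \<open>2 * b = w\<close>, corrected by the term linear in \<open>\<beta> - b\<close>. The weight \<open>M\<close> may tend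
  to 0, so its monotonicity only gives \<open>M * (\<beta> - b)\<^sup>2 \<longlongrightarrow> 0\<close>; but where \<open>\<beta>\<close> is away from \<open>b\<close>
  this makes the forcing negligible, so all levels other than \<open>b\<close> are crossed upwards only.\<close>

lemma lotka_volterra_convergent:
  fixes \<beta> M \<theta> \<theta>' :: "real \<Rightarrow> real"
  assumes der\<beta>: "\<And>s. s0 \<le> s \<Longrightarrow>
      (\<beta> has_real_derivative \<beta> s * (w - \<beta> s) - \<theta> s * M s powr a) (at s)"
    and derM: "\<And>s. s0 \<le> s \<Longrightarrow> (M has_real_derivative 2 * (\<beta> s - b) * M s) (at s)"
    and der\<theta>: "\<And>s. s0 \<le> s \<Longrightarrow> (\<theta> has_real_derivative \<theta>' s) (at s)"
    and \<theta>': "\<And>s. s0 \<le> s \<Longrightarrow> \<theta>' s \<le> 0"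
    and \<theta>: "\<And>s. s0 \<le> s \<Longrightarrow> c0 \<le> \<theta> s" and "0 < c0"
    and bnd: "\<And>s. s0 \<le> s \<Longrightarrow> 0 \<le> \<beta> s \<and> \<beta> s \<le> w"
    and M: "\<And>s. s0 \<le> s \<Longrightarrow> 0 < M s"
    and "0 < a" and "w < 2 * b"
  shows "\<exists>L. (\<beta> \<longlongrightarrow> L) at_top \<and> 0 \<le> L \<and> L \<le> w"
proof -
  \<comment> \<open>\<open>D\<close> measures the distance from the conservative case; its
    positivity supplies the dissipation \<open>2 * D * f\<close>.\<close>
  define D where "D = 2 * b - w"
  have D: "0 < D" using \<open>w < 2 * b\<close> by (simp add: D_def)
  have w0: "0 \<le> w" using bnd[of s0] by simp
  then have b0: "0 < b" using \<open>w < 2 * b\<close> by simp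
  define F where "F s = \<theta> s * M s powr a" for s
  define X where "X s = \<beta> s * (w - \<beta> s) - F s / (a + 1) + D * (\<beta> s - b)" for s
  define \<Lambda> where "\<Lambda> s = M s * X s" for s
  define f where "f s = M s * (\<beta> s - b)^2" for s
  define F' where "F' s = \<theta>' s * M s powr a + 2 * a * (\<beta> s - b) * F s" for s
  have F0: "0 \<le> F s" if "s0 \<le> s" for s
    using \<theta>[OF that] \<open>0 < c0\<close> by (simp add: F_def)
  have der\<beta>': "(\<beta> has_real_derivative \<beta> s * (w - \<beta> s) - F s) (at s)" if "s0 \<le> s" for s
    using der\<beta>[OF that] by (simp add: F_def)
  have derF: "(F has_real_derivative F' s) (at s)" if "s0 \<le> s" for s
    unfolding F_def[abs_def]
  proof (rule DERIV_cong)
    show "((\<lambda>s. \<theta> s * M s powr a) has_real_derivative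
        \<theta>' s * M s powr a + (a * M s powr (a - 1) * (2 * (\<beta> s - b) * M s)) * \<theta> s) (at s)"
      using M[OF that]
      by (intro DERIV_mult der\<theta> that DERIV_chain2[where f = "\<lambda>x. x powr a", OF _ derM]
          has_real_derivative_powr) auto
    have "M s powr a = M s powr (a - 1) * M s"
      using M[OF that] by (simp add: powr_diff)
    then show "\<theta>' s * M s powr a + (a * M s powr (a - 1) * (2 * (\<beta> s - b) * M s)) * \<theta> s = F' s"
      unfolding F'_def F_def by algebra
  qed
  \<comment> \<open>The derivative of \<open>\<Lambda>\<close> along the system reduces to the
    dissipation and a term that is nonnegative because \<open>\<theta>\<close> decreases.\<close>
  define \<Lambda>' where "\<Lambda>' s = 2 * D * f s - M s * (\<theta>' s * M s powr a) / (a + 1)" for s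
  have der\<Lambda>: "(\<Lambda> has_real_derivative \<Lambda>' s) (at s)" if "s0 \<le> s" for s
  proof -
    define i where "i = inverse (a + 1)"
    have i: "(a + 1) * i = 1" using \<open>0 < a\<close> by (simp add: i_def)
    have \<Lambda>_eq: "\<Lambda> = (\<lambda>s. M s * (\<beta> s * (w - \<beta> s) - F s * i + D * (\<beta> s - b)))"
      by (simp add: fun_eq_iff \<Lambda>_def X_def i_def divide_inverse)
    define e where "e = \<theta>' s * M s powr a"
    have F': "F' s = e + 2 * a * (\<beta> s - b) * F s" by (simp add: F'_def e_def)
    have \<Lambda>': "\<Lambda>' s = 2 * D * (M s * (\<beta> s - b)^2) - M s * e * i"
      by (simp add: \<Lambda>'_def f_def e_def i_def divide_inverse)
    show ?thesis
      unfolding \<Lambda>_eq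
    proof (rule DERIV_cong)
      show "((\<lambda>s. M s * (\<beta> s * (w - \<beta> s) - F s * i + D * (\<beta> s - b))) has_real_derivative
        2 * (\<beta> s - b) * M s * (\<beta> s * (w - \<beta> s) - F s * i + D * (\<beta> s - b)) + M s *
        ((\<beta> s * (w - \<beta> s) - F s) * (w - \<beta> s) + \<beta> s * (- (\<beta> s * (w - \<beta> s) - F s))
          - F' s * i + D * (\<beta> s * (w - \<beta> s) - F s))) (at s)"
        by (rule derivative_eq_intros derM der\<beta>' derF that refl)+ (simp add: algebra_simps)
      show "2 * (\<beta> s - b) * M s * (\<beta> s * (w - \<beta> s) - F s * i + D * (\<beta> s - b)) + M s *
        ((\<beta> s * (w - \<beta> s) - F s) * (w - \<beta> s) + \<beta> s * (- (\<beta> s * (w - \<beta> s) - F s))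
          - F' s * i + D * (\<beta> s * (w - \<beta> s) - F s)) = \<Lambda>' s"
        unfolding \<Lambda>' F' D_def using i by algebra
    qed
  qed
  have f0: "0 \<le> f s" if "s0 \<le> s" for s using M[OF that] by (simp add: f_def)
  have \<Lambda>'_ge: "2 * D * f s \<le> \<Lambda>' s" if "s0 \<le> s" for s
  proof -
    have "M s * (\<theta>' s * M s powr a) / (a + 1) \<le> 0"
      using \<theta>'[OF that] M[OF that] \<open>0 < a\<close>
      by (intro divide_nonpos_pos mult_nonneg_nonpos mult_nonpos_nonneg) auto
    then show ?thesis by (simp add: \<Lambda>'_def)
  qed
  have \<Lambda>_mono: "\<Lambda> s0 \<le> \<Lambda> s" if "s0 \<le> s" for s
  proof -
    have "0 * (s - s0) \<le> \<Lambda> s - \<Lambda> s0"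
    proof (rule diff_ge_deriv_bound[where f' = \<Lambda>'])
      show "0 \<le> \<Lambda>' t" if "s0 \<le> t" for t
        using \<Lambda>'_ge[OF that] f0[OF that] D by (intro order_trans[OF _ \<Lambda>'_ge[OF that]]) simp
    qed (use that in \<open>auto intro: has_field_derivative_at_within[OF der\<Lambda>]\<close>)
    then show ?thesis by simp
  qed
  define C where "C = w * w + D * w"
  have X_le: "X s \<le> C - F s / (a + 1)" and X_le': "X s \<le> C" if "s0 \<le> s" for s
  proof -
    have "\<beta> s * (w - \<beta> s) \<le> w * w" using bnd[OF that] w0 by (intro mult_mono) auto
    moreover have "D * (\<beta> s - b) \<le> D * w" using bnd[OF that] D b0 by (intro mult_left_mono) auto
    ultimately show "X s \<le> C - F s / (a + 1)" by (simp add: X_def C_def)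
    moreover have "0 \<le> F s / (a + 1)" using F0[OF that] \<open>0 < a\<close> by simp
    ultimately show "X s \<le> C" by linarith
  qed
  have C0: "0 \<le> C" using w0 D by (simp add: C_def)
  \<comment> \<open>For \<open>M s > B\<close> the bound \<open>F s \<ge> c0 * M s powr a\<close>
    pushes \<open>X s\<close> down to \<open>- (\<bar>\<Lambda> s0\<bar> + 1)\<close> or less; as
    also \<open>M s > 1\<close>, the product \<open>\<Lambda> s = M s * X s\<close> would lie below
    \<open>\<Lambda> s0\<close>.\<close>
  define B where "B = max 1 (((C + \<bar>\<Lambda> s0\<bar> + 1) * (a + 1) / c0) powr (1 / a))"
  have MB: "M s \<le> B" if "s0 \<le> s" for s
  proof (rule ccontr)
    assume "\<not> M s \<le> B"
    then have M1: "1 < M s" and "((C + \<bar>\<Lambda> s0\<bar> + 1) * (a + 1) / c0) powr (1 / a) < M s"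
      by (auto simp: B_def)
    then have "(((C + \<bar>\<Lambda> s0\<bar> + 1) * (a + 1) / c0) powr (1 / a)) powr a \<le> M s powr a"
      using \<open>0 < a\<close> by (intro powr_mono2) auto
    moreover have "(((C + \<bar>\<Lambda> s0\<bar> + 1) * (a + 1) / c0) powr (1 / a)) powr a
        = (C + \<bar>\<Lambda> s0\<bar> + 1) * (a + 1) / c0"
      using \<open>0 < a\<close> \<open>0 < c0\<close> C0 by (simp add: powr_powr)
    ultimately have "(C + \<bar>\<Lambda> s0\<bar> + 1) * (a + 1) / c0 \<le> M s powr a" by linarith
    then have "(C + \<bar>\<Lambda> s0\<bar> + 1) * (a + 1) \<le> c0 * M s powr a"
      using \<open>0 < c0\<close> by (simp add: pos_divide_le_eq mult.commute)
    also have "\<dots> \<le> F s" using \<theta>[OF that] by (simp add: F_def mult_right_mono)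
    finally have "C + \<bar>\<Lambda> s0\<bar> + 1 \<le> F s / (a + 1)" using \<open>0 < a\<close> by (simp add: field_simps)
    then have X: "X s \<le> - (\<bar>\<Lambda> s0\<bar> + 1)" using X_le[OF that] by linarith
    then have "M s * X s \<le> 1 * X s" using M1 by (intro mult_right_mono_neg) auto
    then show False using X \<Lambda>_mono[OF that] by (simp add: \<Lambda>_def)
  qed
  have B1: "1 \<le> B" by (simp add: B_def)
  have \<theta>_le: "\<theta> s \<le> \<theta> s0" if "s0 \<le> s" for s
  proof -
    have "\<theta> s - \<theta> s0 \<le> 0 * (s - s0)"
      by (rule diff_le_deriv_bound[where f' = \<theta>'])
        (use that in \<open>auto intro: has_field_derivative_at_within[OF der\<theta>] \<theta>'\<close>)
    then show ?thesis by simp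
  qed
  define FB where "FB = \<theta> s0 * B powr a"
  have FB: "F s \<le> FB" if "s0 \<le> s" for s
    unfolding F_def FB_def using \<theta>_le[OF that] \<theta>[of s0] \<open>0 < c0\<close> MB[OF that] M[OF that] \<open>0 < a\<close>
    by (intro mult_mono powr_mono2) auto
  have FB0: "0 \<le> FB" using FB[of s0] F0[of s0] by linarith
  have \<beta>b: "\<bar>\<beta> s - b\<bar> \<le> w + b" if "s0 \<le> s" for s using bnd[OF that] b0 w0 by auto
  have f_lim: "((\<lambda>s. 2 * D * f s) \<longlongrightarrow> 0) at_top"
  proof (rule barbalat[where \<Lambda> = \<Lambda> and \<Lambda>' = \<Lambda>' and ?s0.0 = s0 and B = "B * C"])
    fix s assume s: "s0 \<le> s"
    let ?h = "\<beta> s - b" and ?g = "\<beta> s * (w - \<beta> s) - F s"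
    show "((\<lambda>s. 2 * D * f s) has_real_derivative
      2 * D * (2 * ?h * M s * ?h^2 + M s * (2 * ?h * ?g))) (at s)"
      unfolding f_def[abs_def]
      by (rule derivative_eq_intros derM der\<beta>' s refl)+ (simp add: algebra_simps)
    have h: "\<bar>?h\<bar> \<le> w + b" by (rule \<beta>b[OF s])
    have g: "\<bar>?g\<bar> \<le> w * w + FB"
    proof -
      have "\<beta> s * (w - \<beta> s) \<le> w * w" "0 \<le> \<beta> s * (w - \<beta> s)"
        using bnd[OF s] w0 by (auto intro!: mult_mono)
      then show ?thesis using F0[OF s] FB[OF s] w0 FB0 by auto
    qed
    have m: "\<bar>M s\<bar> \<le> B" using MB[OF s] M[OF s] by simp
    have "\<bar>2 * ?h * M s * ?h^2\<bar> \<le> 2 * (w + b) * B * (w + b)^2"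
      unfolding abs_mult power2_eq_square using h m w0 b0 B1 by (intro mult_mono) auto
    moreover have "\<bar>M s * (2 * ?h * ?g)\<bar> \<le> B * (2 * (w + b) * (w * w + FB))"
      unfolding abs_mult using h m g w0 b0 B1 by (intro mult_mono) auto
    ultimately have "\<bar>2 * ?h * M s * ?h^2 + M s * (2 * ?h * ?g)\<bar>
        \<le> 2 * (w + b) * B * (w + b)^2 + B * (2 * (w + b) * (w * w + FB))" by linarith
    then show "\<bar>2 * D * (2 * ?h * M s * ?h^2 + M s * (2 * ?h * ?g))\<bar>
        \<le> 2 * D * (2 * (w + b) * B * (w + b)^2 + B * (2 * (w + b) * (w * w + FB)))"
      using D by (subst abs_mult) (auto intro!: mult_left_mono)
    show "0 \<le> 2 * D * f s" using f0[OF s] D by simp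
    show "(\<Lambda> has_real_derivative \<Lambda>' s) (at s)" by (rule der\<Lambda>[OF s])
    show "2 * D * f s \<le> \<Lambda>' s" by (rule \<Lambda>'_ge[OF s])
    have "M s * X s \<le> M s * C" using X_le'[OF s] M[OF s] by (intro mult_left_mono) auto
    also have "\<dots> \<le> B * C" using MB[OF s] C0 by (intro mult_right_mono) auto
    finally show "\<Lambda> s \<le> B * C" by (simp add: \<Lambda>_def)
  qed
  have f_lim: "(f \<longlongrightarrow> 0) at_top"
    using tendsto_mult[OF tendsto_const[of "1 / (2 * D)"] f_lim] D by simp
  show ?thesis
  proof (rule transversal_convergent[OF der\<beta>' bnd])
    show "finite {b}" by simp
    fix c assume c: "c \<notin> {b}" "0 < c" "c < w"
    have bc: "0 < (c - b)^2" using c by simp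
    \<comment> \<open>Where \<open>\<beta> s = c\<close>, the weight \<open>M s\<close> equals
      \<open>f s / (c - b)^2\<close>, so the forcing is at most
      \<open>\<theta> s0 * (f s / (c - b)^2) powr a\<close>. This tends to 0 and ends up below the
      positive number \<open>c * (w - c)\<close>.\<close>
    have "((\<lambda>s. f s / (c - b)^2) \<longlongrightarrow> 0 / (c - b)^2) at_top"
      by (intro tendsto_divide f_lim tendsto_const) (use bc in auto)
    then have "((\<lambda>s. (f s / (c - b)^2) powr a) \<longlongrightarrow> (0 / (c - b)^2) powr a) at_top"
    proof (rule tendsto_powr2)
      show "\<forall>\<^sub>F s in at_top. 0 \<le> f s / (c - b)^2"
        using eventually_ge_at_top[of s0] by eventually_elim (simp add: f0)
    qed (use \<open>0 < a\<close> in auto)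
    then have "((\<lambda>s. \<theta> s0 * (f s / (c - b)^2) powr a) \<longlongrightarrow> \<theta> s0 * 0) at_top"
      by (intro tendsto_intros) (use bc \<open>0 < a\<close> in simp)
    then have "\<forall>\<^sub>F s in at_top. \<theta> s0 * (f s / (c - b)^2) powr a < c * (w - c)"
      by (rule order_tendstoD(2)) (use c in simp)
    with eventually_ge_at_top[of s0]
    have "\<forall>\<^sub>F s in at_top. \<beta> s = c \<longrightarrow> 0 < \<beta> s * (w - \<beta> s) - F s"
    proof eventually_elim
      case (elim s)
      show ?case
      proof
        assume "\<beta> s = c"
        then have "M s = f s / (c - b)^2" using c by (simp add: f_def)
        moreover have "F s \<le> \<theta> s0 * M s powr a"
          unfolding F_def using \<theta>_le[of s] elim by (intro mult_right_mono) auto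
        ultimately show "0 < \<beta> s * (w - \<beta> s) - F s" using elim \<open>\<beta> s = c\<close> by simp
      qed
    qed
    then show "(\<forall>\<^sub>F s in at_top. \<beta> s = c \<longrightarrow> 0 < \<beta> s * (w - \<beta> s) - F s) \<or>
      (\<forall>\<^sub>F s in at_top. \<beta> s = c \<longrightarrow> \<beta> s * (w - \<beta> s) - F s < 0)" ..
  qed
qed

section \<open>Local existence by power series\<close>

text \<open>Taylor coefficients at time 0 of the solution with initial value \<open>x0\<close>; index 0 stands
  for the density and the indices \<open>1..n\<close> for the eigenvalues.\<close>

fun flow_coeff :: "nat \<Rightarrow> real \<Rightarrow> real \<Rightarrow> (nat \<Rightarrow> real) \<Rightarrow> nat \<Rightarrow> nat \<Rightarrow> real" where
  "flow_coeff n \<kappa> c x0 0 i = x0 i"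
| "flow_coeff n \<kappa> c x0 (Suc m) i =
    (if i = 0 then - (\<Sum>l\<le>m. flow_coeff n \<kappa> c x0 l 0 * (\<Sum>q=1..n. flow_coeff n \<kappa> c x0 (m - l) q))
     else - (\<Sum>l\<le>m. flow_coeff n \<kappa> c x0 l i * flow_coeff n \<kappa> c x0 (m - l) i)
       + \<kappa> * flow_coeff n \<kappa> c x0 m 0 - (if m = 0 then c else 0)) / real (Suc m)"

text \<open>A geometric majorant. Every summand of a convolution carries the same power of
  \<open>R\<close>, so the sum gains only the number of summands, which the recursion divides out.
  \<open>R\<close> absorbs the other constants, and \<open>1 \<le> M\<close> lets it absorb
  \<open>c\<close> as well.\<close>

lemma flow_coeff_bound:
  assumes x0: "\<And>i. i \<le> n \<Longrightarrow> \<bar>x0 i\<bar> \<le> M" and "1 \<le> M"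
    and R: "R = real n * M + M + \<bar>\<kappa>\<bar> + \<bar>c\<bar>"
  shows "i \<le> n \<Longrightarrow> \<bar>flow_coeff n \<kappa> c x0 m i\<bar> \<le> M * R ^ m"
proof (induction m arbitrary: i rule: less_induct)
  case (less m)
  have "0 \<le> real n * M" using \<open>1 \<le> M\<close> by simp
  then have R1: "1 \<le> R" unfolding R using \<open>1 \<le> M\<close> by linarith
  show ?case
  proof (cases m)
    case 0
    then show ?thesis using x0 less.prems by simp
  next
    case (Suc p)
    let ?a = "flow_coeff n \<kappa> c x0"
    have IH: "\<bar>?a l q\<bar> \<le> M * R ^ l" if "l \<le> p" "q \<le> n" for l q
      using less.IH[of l q] that Suc by simp
    have M0: "0 \<le> M" using \<open>1 \<le> M\<close> by simp
    have Rp: "1 \<le> R ^ p" using R1 by simp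
    have MR: "M * R ^ m = M * R * R ^ p" by (simp add: Suc)
    show ?thesis
    proof (cases "i = 0")
      case True
      have "\<bar>\<Sum>l\<le>p. ?a l 0 * (\<Sum>q=1..n. ?a (p - l) q)\<bar> \<le> (\<Sum>l\<le>p. (M * R ^ l) * (real n * (M * R ^ (p - l))))"
      proof (rule order_trans[OF sum_abs], rule sum_mono)
        fix l assume l: "l \<in> {..p}"
        have "\<bar>\<Sum>q=1..n. ?a (p - l) q\<bar> \<le> (\<Sum>q=1..n. M * R ^ (p - l))"
          by (rule order_trans[OF sum_abs], rule sum_mono) (auto intro!: IH)
        then have "\<bar>\<Sum>q=1..n. ?a (p - l) q\<bar> \<le> real n * (M * R ^ (p - l))" by simp
        then show "\<bar>?a l 0 * (\<Sum>q=1..n. ?a (p - l) q)\<bar> \<le> (M * R ^ l) * (real n * (M * R ^ (p - l)))"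
          unfolding abs_mult using IH[of l 0] l M0 R1 by (intro mult_mono) auto
      qed
      also have "\<dots> = (\<Sum>l\<le>p. real n * M * M * R ^ p)"
        by (intro sum.cong refl) (simp add: power_add[symmetric] mult_ac flip: power_add)
      also have "\<dots> = real (Suc p) * (M * (real n * M) * R ^ p)" by simp
      also have "\<dots> \<le> real (Suc p) * (M * R * R ^ p)"
        unfolding R using M0 R1[unfolded R] by (intro mult_left_mono mult_right_mono) auto
      finally show ?thesis
        unfolding MR using Suc True by (simp add: field_simps del: of_nat_Suc)
    next
      case False
      have "\<bar>\<Sum>l\<le>p. ?a l i * ?a (p - l) i\<bar> \<le> (\<Sum>l\<le>p. (M * R ^ l) * (M * R ^ (p - l)))"
      proof (rule order_trans[OF sum_abs], rule sum_mono)
        fix l assume "l \<in> {..p}"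
        then show "\<bar>?a l i * ?a (p - l) i\<bar> \<le> (M * R ^ l) * (M * R ^ (p - l))"
          unfolding abs_mult using IH[of l i] IH[of "p - l" i] less.prems M0 R1
          by (intro mult_mono) auto
      qed
      also have "\<dots> = (\<Sum>l\<le>p. M * M * R ^ p)"
        by (intro sum.cong refl) (simp add: power_add[symmetric] mult_ac flip: power_add)
      also have "\<dots> = real (Suc p) * (M * M * R ^ p)" by simp
      finally have 1: "\<bar>\<Sum>l\<le>p. ?a l i * ?a (p - l) i\<bar> \<le> real (Suc p) * (M * M * R ^ p)" .
      have "\<bar>\<kappa> * ?a p 0\<bar> \<le> \<bar>\<kappa>\<bar> * (M * R ^ p)"
        unfolding abs_mult using IH[of p 0] by (intro mult_left_mono) auto
      also have "\<dots> \<le> real (Suc p) * (\<bar>\<kappa>\<bar> * (M * R ^ p))"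
        using mult_right_mono[of 1 "real (Suc p)" "\<bar>\<kappa>\<bar> * (M * R ^ p)"] M0 R1 by simp
      finally have 2: "\<bar>\<kappa> * ?a p 0\<bar> \<le> real (Suc p) * (M * \<bar>\<kappa>\<bar> * R ^ p)" by (simp add: mult_ac)
      have "\<bar>if p = 0 then c else 0\<bar> \<le> 1 * (1 * \<bar>c\<bar> * 1)" by simp
      also have "\<dots> \<le> real (Suc p) * (M * \<bar>c\<bar> * R ^ p)"
        using M0 R1 Rp \<open>1 \<le> M\<close> by (intro mult_mono) auto
      finally have 3: "\<bar>if p = 0 then c else 0\<bar> \<le> real (Suc p) * (M * \<bar>c\<bar> * R ^ p)" .
      have "\<bar>?a m i\<bar> * real (Suc p) =
        \<bar>- (\<Sum>l\<le>p. ?a l i * ?a (p - l) i) + \<kappa> * ?a p 0 - (if p = 0 then c else 0)\<bar>"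
        using Suc False by simp
      also have "\<dots> \<le> real (Suc p) * (M * M * R ^ p) + real (Suc p) * (M * \<bar>\<kappa>\<bar> * R ^ p)
          + real (Suc p) * (M * \<bar>c\<bar> * R ^ p)"
        using 1 2 3 by linarith
      also have "\<dots> = real (Suc p) * (M * (M + \<bar>\<kappa>\<bar> + \<bar>c\<bar>) * R ^ p)" by (simp add: algebra_simps)
      also have "\<dots> \<le> real (Suc p) * (M * R * R ^ p)"
        unfolding R using M0 R1[unfolded R] by (intro mult_left_mono mult_right_mono) auto
      finally show ?thesis
        unfolding MR by (simp add: field_simps del: of_nat_Suc)
    qed
  qed
qed

text \<open>The coefficients are built so that the termwise derivative of each series is the
  combination of Cauchy products on the right-hand side; the majorant gives convergence for
  \<open>\<bar>t\<bar> < 1 / R\<close>. The interval is two-sided, as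
  \<open>glue_has_real_derivative\<close> demands.\<close>

lemma flow_local_solution:
  fixes x0 :: "nat \<Rightarrow> real"
  shows "\<exists>e > 0. \<exists>X :: nat \<Rightarrow> real \<Rightarrow> real. (\<forall>i\<le>n. X i 0 = x0 i) \<and>
    (\<forall>t. \<bar>t\<bar> < e \<longrightarrow>
      (X 0 has_real_derivative - X 0 t * (\<Sum>i=1..n. X i t)) (at t) \<and>
      (\<forall>i\<in>{1..n}. (X i has_real_derivative - (X i t)\<^sup>2 + \<kappa> * X 0 t - c) (at t)))"
proof -
  define M where "M = Max (insert 1 ((\<lambda>i. \<bar>x0 i\<bar>) ` {..n}))"
  have M1: "1 \<le> M" and Mx: "\<And>i. i \<le> n \<Longrightarrow> \<bar>x0 i\<bar> \<le> M"
    unfolding M_def by (rule Max_ge; simp)+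
  define R where "R = real n * M + M + \<bar>\<kappa>\<bar> + \<bar>c\<bar>"
  have R: "0 < R" unfolding R_def using M1 by (intro add_pos_nonneg add_nonneg_pos) auto
  define a where "a = flow_coeff n \<kappa> c x0"
  define X where "X i t = (\<Sum>m. a m i * t ^ m)" for i t
  define e where "e = 1 / R"
  have bnd: "\<bar>a m i\<bar> \<le> M * R ^ m" if "i \<le> n" for m i
    unfolding a_def using flow_coeff_bound[of n x0 M R \<kappa> c i m] Mx M1 R_def that by blast
  have abssum: "summable (\<lambda>m. norm (a m i * t ^ m))" if "i \<le> n" "\<bar>t\<bar> < e" for i t
  proof (rule summable_comparison_test_ev)
    show "\<forall>\<^sub>F m in sequentially. norm (norm (a m i * t ^ m)) \<le> M * (R * \<bar>t\<bar>) ^ m"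
    proof (intro always_eventually allI)
      fix m
      have "\<bar>a m i\<bar> * \<bar>t\<bar> ^ m \<le> (M * R ^ m) * \<bar>t\<bar> ^ m"
        using bnd[OF that(1)] by (intro mult_right_mono) auto
      then show "norm (norm (a m i * t ^ m)) \<le> M * (R * \<bar>t\<bar>) ^ m"
        by (simp add: abs_mult power_abs power_mult_distrib mult_ac)
    qed
    have "R * \<bar>t\<bar> < 1" using that R by (simp add: e_def field_simps)
    then show "summable (\<lambda>m. M * (R * \<bar>t\<bar>) ^ m)"
      using R by (intro summable_mult summable_geometric) (simp add: abs_mult)
  qed
  have sums: "(\<lambda>m. a m i * t ^ m) sums X i t" if "i \<le> n" "\<bar>t\<bar> < e" for i t
    unfolding X_def by (rule summable_sums[OF summable_norm_cancel[OF abssum[OF that]]])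
  have der: "(X i has_real_derivative (\<Sum>m. diffs (\<lambda>m. a m i) m * t ^ m)) (at t)"
    if i: "i \<le> n" and t: "\<bar>t\<bar> < e" for i t
  proof -
    obtain K where K: "\<bar>t\<bar> < K" "K < e" using dense[OF t] by blast
    show ?thesis
      unfolding X_def
    proof (rule termdiffs_strong[where K = K])
      show "summable (\<lambda>m. a m i * K ^ m)"
        by (rule summable_norm_cancel[OF abssum]) (use i K in auto)
    qed (use K in auto)
  qed
  \<comment> \<open>The second factor is left arbitrary: it is a single series for the squares and a
    finite sum of series for the density.\<close>
  have prod: "(\<lambda>m. (\<Sum>l\<le>m. a l i * b (m - l)) * t ^ m) sums (X i t * y)"
    if "i \<le> n" "\<bar>t\<bar> < e" "summable (\<lambda>m. norm (b m * t ^ m))" "(\<lambda>m. b m * t ^ m) sums y" for i t b y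
  proof -
    have "(\<lambda>m. \<Sum>l\<le>m. (a l i * t ^ l) * (b (m - l) * t ^ (m - l))) sums
        ((\<Sum>m. a m i * t ^ m) * (\<Sum>m. b m * t ^ m))"
      using that abssum by (intro Cauchy_product_sums) auto
    moreover have "(\<Sum>l\<le>m. (a l i * t ^ l) * (b (m - l) * t ^ (m - l)))
        = (\<Sum>l\<le>m. a l i * b (m - l)) * t ^ m" for m
      unfolding sum_distrib_right
      by (intro sum.cong refl) (simp add: mult_ac flip: power_add)
    ultimately show ?thesis using sums_unique[OF that(4)] by (simp add: X_def)
  qed
  have "(X 0 has_real_derivative - X 0 t * (\<Sum>i=1..n. X i t)) (at t)" if t: "\<bar>t\<bar> < e" for t
  proof -
    have "(\<lambda>m. (\<Sum>q=1..n. a m q) * t ^ m) sums (\<Sum>i=1..n. X i t)"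
      unfolding sum_distrib_right by (intro sums_sum sums) (use t in auto)
    moreover have "summable (\<lambda>m. norm ((\<Sum>q=1..n. a m q) * t ^ m))"
    proof (rule summable_comparison_test_ev)
      show "summable (\<lambda>m. \<Sum>q=1..n. norm (a m q * t ^ m))"
        by (intro summable_sum abssum) (use t in auto)
      show "\<forall>\<^sub>F m in sequentially. norm (norm ((\<Sum>q=1..n. a m q) * t ^ m))
          \<le> (\<Sum>q=1..n. norm (a m q * t ^ m))"
        unfolding sum_distrib_right by (intro always_eventually allI) (simp add: sum_abs)
    qed
    ultimately have "(\<lambda>m. - ((\<Sum>l\<le>m. a l 0 * (\<Sum>q=1..n. a (m - l) q)) * t ^ m)) sums
        (- (X 0 t * (\<Sum>i=1..n. X i t)))"
      using t by (intro sums_minus prod) auto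
    moreover have "- ((\<Sum>l\<le>m. a l 0 * (\<Sum>q=1..n. a (m - l) q)) * t ^ m)
        = diffs (\<lambda>m. a m 0) m * t ^ m" for m
      by (simp add: diffs_def a_def del: of_nat_Suc)
    ultimately have "(\<lambda>m. diffs (\<lambda>m. a m 0) m * t ^ m) sums (- (X 0 t * (\<Sum>i=1..n. X i t)))"
      by simp
    from sums_unique[OF this] show ?thesis using der[of 0 t] t by simp
  qed
  moreover have "(X i has_real_derivative - (X i t)\<^sup>2 + \<kappa> * X 0 t - c) (at t)"
    if i: "i \<in> {1..n}" and t: "\<bar>t\<bar> < e" for i t
  proof -
    have "(\<lambda>m. - ((\<Sum>l\<le>m. a l i * a (m - l) i) * t ^ m) + \<kappa> * (a m 0 * t ^ m)
        - (if m = 0 then c else 0)) sums (- (X i t * X i t) + \<kappa> * X 0 t - c)"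
      using i t abssum
      by (intro sums_diff sums_add sums_minus prod sums_mult sums sums_single) auto
    moreover have "- ((\<Sum>l\<le>m. a l i * a (m - l) i) * t ^ m) + \<kappa> * (a m 0 * t ^ m)
        - (if m = 0 then c else 0) = diffs (\<lambda>m. a m i) m * t ^ m" for m
    proof -
      have d: "diffs (\<lambda>m. a m i) m = - (\<Sum>l\<le>m. a l i * a (m - l) i) + \<kappa> * a m 0
          - (if m = 0 then c else 0)"
        using i by (simp add: diffs_def a_def del: of_nat_Suc)
      show ?thesis unfolding d by (cases "m = 0") (simp_all add: algebra_simps)
    qed
    ultimately have "(\<lambda>m. diffs (\<lambda>m. a m i) m * t ^ m) sums (- (X i t * X i t) + \<kappa> * X 0 t - c)"
      by simp
    from sums_unique[OF this] show ?thesis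
      using der[of i t] t i by (simp add: power2_eq_square)
  qed
  moreover have "X i 0 = x0 i" if "i \<le> n" for i
  proof -
    have "X i 0 = a 0 i" unfolding X_def by (rule powser_zero)
    then show ?thesis by (simp add: a_def)
  qed
  moreover have "0 < e" using R by (simp add: e_def)
  ultimately show ?thesis by blast
qed

text \<open>Only the junction \<open>T\<close> needs an argument: from the left, l'Hopital's rule
  turns the limit of \<open>f'\<close> into that of the difference quotient; from the right the
  quotient is that of \<open>g\<close> at 0.\<close>

lemma glue_has_real_derivative:
  fixes f g :: "real \<Rightarrow> real"
  assumes "0 < T" "0 < e"
    and derf: "\<And>t. 0 \<le> t \<Longrightarrow> t < T \<Longrightarrow> (f has_real_derivative f' t) (at t within {0..<T})"
    and derg: "\<And>t. \<bar>t\<bar> < e \<Longrightarrow> (g has_real_derivative g' t) (at t)"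
    and f: "(f \<longlongrightarrow> g 0) (at_left T)" and f': "(f' \<longlongrightarrow> g' 0) (at_left T)"
    and t: "0 \<le> t" "t < T + e"
  defines "h \<equiv> \<lambda>t. if t < T then f t else g (t - T)"
  shows "(h has_real_derivative (if t < T then f' t else g' (t - T))) (at t within {0..<T + e})"
proof -
  consider "t < T" | "T < t" | "t = T" by linarith
  then show ?thesis
  proof cases
    case 1
    have "at t within {0..<T + e} = at t within {0..<T}"
      by (rule at_within_nhd[of _ "{..<T}"]) (use 1 \<open>0 < e\<close> in auto)
    moreover have "(h has_real_derivative f' t) (at t within {0..<T})"
      by (rule has_field_derivative_transform_within[OF derf zero_less_one])
        (use t 1 in \<open>auto simp: h_def\<close>)
    ultimately show ?thesis using 1 by simp
  next
    case 2
    have "((\<lambda>t. g (t - T)) has_real_derivative g' (t - T)) (at t)"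
      by (rule DERIV_cong[OF DERIV_chain2[OF derg]]) (use 2 t in \<open>auto intro!: derivative_eq_intros\<close>)
    then have "(h has_real_derivative g' (t - T)) (at t)"
      by (rule has_field_derivative_transform_within_open[where S = "{T<..}"])
        (use 2 in \<open>auto simp: h_def\<close>)
    then show ?thesis using 2 by (auto intro: has_field_derivative_at_within)
  next
    case 3
    have hT: "h T = g 0" by (simp add: h_def)
    have "((\<lambda>y. (f y - g 0) / (y - T)) \<longlongrightarrow> g' 0) (at_left T)"
    proof (rule lhopital_left)
      show "((\<lambda>y. f y - g 0) \<longlongrightarrow> 0) (at_left T)" using f by (simp add: LIM_zero)
      show "((\<lambda>y. y - T) \<longlongrightarrow> 0) (at_left T)" by (auto intro!: tendsto_eq_intros)
      show "\<forall>\<^sub>F y in at_left T. y - T \<noteq> 0" by (auto simp: eventually_at_filter)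
      show "\<forall>\<^sub>F y in at_left T. (1::real) \<noteq> 0" by simp
      show "\<forall>\<^sub>F y in at_left T. ((\<lambda>y. f y - g 0) has_real_derivative f' y) (at y)"
        using eventually_at_left_real[OF \<open>0 < T\<close>]
      proof eventually_elim
        case (elim y)
        then have "(f has_real_derivative f' y) (at y)"
          using derf[of y] at_within_interior[of y "{0..<T}"] by simp
        then show ?case by (auto intro!: derivative_eq_intros)
      qed
      show "\<forall>\<^sub>F y in at_left T. ((\<lambda>y. y - T) has_real_derivative 1) (at y)"
        by (auto intro!: always_eventually derivative_eq_intros)
      show "((\<lambda>y. f' y / 1) \<longlongrightarrow> g' 0) (at_left T)" using f' by simp
    qed
    then have "((\<lambda>y. (h y - h T) / (y - T)) \<longlongrightarrow> g' 0) (at_left T)"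
      by (rule Lim_transform_eventually) (auto simp: h_def eventually_at_filter)
    moreover have "((\<lambda>y. (h y - h T) / (y - T)) \<longlongrightarrow> g' 0) (at_right T)"
    proof (rule Lim_transform_eventually)
      have "((\<lambda>t. g (t - T)) has_real_derivative g' (T - T)) (at T)"
        by (rule DERIV_cong[OF DERIV_chain2[OF derg]]) (use \<open>0 < e\<close> in \<open>auto intro!: derivative_eq_intros\<close>)
      then have "((\<lambda>y. (g (y - T) - g 0) / (y - T)) \<longlongrightarrow> g' 0) (at T)"
        by (simp add: has_field_derivative_iff)
      then show "((\<lambda>y. (g (y - T) - g 0) / (y - T)) \<longlongrightarrow> g' 0) (at_right T)"
        by (rule filterlim_mono) (auto simp: at_le)
    qed (auto simp: h_def eventually_at_filter)
    ultimately have "(h has_real_derivative g' 0) (at T)"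
      by (simp add: has_field_derivative_iff filterlim_split_at)
    then show ?thesis using 3 by (auto intro: has_field_derivative_at_within)
  qed
qed

section \<open>Blow-up at the end of a maximal solution\<close>

text \<open>Bounds on the unknowns bound their derivatives, so all of them have limits at
  \<open>T\<close>. The power series solution started from these limits is appended; the equations
  themselves give the limits of the derivatives that gluing requires.\<close>

lemma bounded_solution_extends:
  assumes sol: "is_solution n k cb rho0 lam0 T lam rho"
    and bl: "\<And>i t. i \<in> {1..n} \<Longrightarrow> t \<in> {0..<T} \<Longrightarrow> \<bar>lam i t\<bar> \<le> B"
    and br: "\<And>t. t \<in> {0..<T} \<Longrightarrow> \<bar>rho t\<bar> \<le> B"
  shows "\<exists>T' lam' rho'. T < T' \<and> is_solution n k cb rho0 lam0 T' lam' rho' \<and>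
    (\<forall>t\<in>{0..<T}. rho' t = rho t \<and> (\<forall>i\<in>{1..n}. lam' i t = lam i t))"
proof -
  define \<kappa> where "\<kappa> = k / real n"
  have T: "0 < T" and init: "rho 0 = rho0" "\<And>i. i \<in> {1..n} \<Longrightarrow> lam i 0 = lam0 i"
    and dl: "\<And>i t. i \<in> {1..n} \<Longrightarrow> 0 \<le> t \<Longrightarrow> t < T \<Longrightarrow>
      (lam i has_real_derivative - (lam i t)\<^sup>2 + \<kappa> * (rho t - cb)) (at t within {0..<T})"
    and dr: "\<And>t. 0 \<le> t \<Longrightarrow> t < T \<Longrightarrow>
      (rho has_real_derivative - rho t * (\<Sum>i=1..n. lam i t)) (at t within {0..<T})"
    using sol by (auto simp: is_solution_def \<kappa>_def)
  have "\<exists>L. (lam i \<longlongrightarrow> L) (at_left T)" if i: "i \<in> {1..n}" for i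
  proof (rule bounded_deriv_tendsto_at_left[OF T dl[OF i]])
    fix t assume t: "0 \<le> t" "t < T"
    have "\<bar>- (lam i t)\<^sup>2 + \<kappa> * (rho t - cb)\<bar> \<le> \<bar>lam i t\<bar>\<^sup>2 + \<bar>\<kappa>\<bar> * \<bar>rho t - cb\<bar>"
      unfolding abs_mult[symmetric] power2_abs using zero_le_power2[of "lam i t"] by linarith
    also have "\<dots> \<le> B\<^sup>2 + \<bar>\<kappa>\<bar> * (B + \<bar>cb\<bar>)"
      using bl[OF i, of t] br[of t] t by (intro add_mono power_mono mult_left_mono) auto
    finally show "\<bar>- (lam i t)\<^sup>2 + \<kappa> * (rho t - cb)\<bar> \<le> B\<^sup>2 + \<bar>\<kappa>\<bar> * (B + \<bar>cb\<bar>)" .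
  qed
  then obtain L where L: "\<And>i. i \<in> {1..n} \<Longrightarrow> (lam i \<longlongrightarrow> L i) (at_left T)" by metis
  have "\<exists>r. (rho \<longlongrightarrow> r) (at_left T)"
  proof (rule bounded_deriv_tendsto_at_left[OF T dr])
    fix t assume t: "0 \<le> t" "t < T"
    have "\<bar>\<Sum>i=1..n. lam i t\<bar> \<le> (\<Sum>i=1..n. B)"
      by (rule order_trans[OF sum_abs sum_mono]) (use bl t in auto)
    then have "\<bar>rho t\<bar> * \<bar>\<Sum>i=1..n. lam i t\<bar> \<le> B * (real n * B)"
      using br[of t] t by (intro mult_mono) auto
    then show "\<bar>- rho t * (\<Sum>i=1..n. lam i t)\<bar> \<le> B * (real n * B)" by (simp add: abs_mult)
  qed
  then obtain r where r: "(rho \<longlongrightarrow> r) (at_left T)" by blast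
  define x0 where "x0 i = (if i = 0 then r else L i)" for i
  obtain e X where e: "0 < e" and X0: "\<And>i. i \<le> n \<Longrightarrow> X i 0 = x0 i"
    and dX0: "\<And>t. \<bar>t\<bar> < e \<Longrightarrow> (X 0 has_real_derivative - X 0 t * (\<Sum>i=1..n. X i t)) (at t)"
    and dX: "\<And>i t. i \<in> {1..n} \<Longrightarrow> \<bar>t\<bar> < e \<Longrightarrow>
      (X i has_real_derivative - (X i t)\<^sup>2 + \<kappa> * X 0 t - \<kappa> * cb) (at t)"
    using flow_local_solution[of n x0 \<kappa> "\<kappa> * cb"] by blast
  have XL: "X i 0 = L i" if "i \<in> {1..n}" for i using X0[of i] that by (simp add: x0_def)
  have Xr: "X 0 0 = r" using X0[of 0] by (simp add: x0_def)
  define lam' where "lam' i t = (if t < T then lam i t else X i (t - T))" for i t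
  define rho' where "rho' t = (if t < T then rho t else X 0 (t - T))" for t
  have "(rho' has_real_derivative - rho' t * (\<Sum>i=1..n. lam' i t)) (at t within {0..<T + e})"
    if "0 \<le> t" "t < T + e" for t
    unfolding rho'_def[abs_def]
    by (rule DERIV_cong[OF glue_has_real_derivative[OF T e dr dX0]])
      (use that in \<open>auto simp: lam'_def rho'_def Xr XL intro!: tendsto_intros r L\<close>)
  moreover have "(lam' i has_real_derivative - (lam' i t)\<^sup>2 + \<kappa> * (rho' t - cb)) (at t within {0..<T + e})"
    if i: "i \<in> {1..n}" and t: "0 \<le> t" "t < T + e" for i t
  proof -
    have "((\<lambda>t. - (lam i t)\<^sup>2 + \<kappa> * (rho t - cb)) \<longlongrightarrow> - (L i)\<^sup>2 + \<kappa> * (r - cb)) (at_left T)"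
      by (intro tendsto_intros r L i)
    then have lim: "((\<lambda>t. - (lam i t)\<^sup>2 + \<kappa> * (rho t - cb)) \<longlongrightarrow>
        - (X i 0)\<^sup>2 + \<kappa> * X 0 0 - \<kappa> * cb) (at_left T)"
      by (simp add: XL[OF i] Xr algebra_simps)
    have lim': "(lam i \<longlongrightarrow> X i 0) (at_left T)" using L[OF i] XL[OF i] by simp
    show ?thesis
      unfolding lam'_def[abs_def]
      by (rule DERIV_cong[OF glue_has_real_derivative[OF T e dl[OF i] dX[OF i] lim' lim t]])
        (auto simp: rho'_def algebra_simps)
  qed
  moreover have "rho' 0 = rho0" "\<And>i. i \<in> {1..n} \<Longrightarrow> lam' i 0 = lam0 i"
    using T init by (auto simp: lam'_def rho'_def)
  ultimately have "is_solution n k cb rho0 lam0 (T + e) lam' rho'"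
    using T e unfolding is_solution_def \<kappa>_def by auto
  moreover have "\<forall>t\<in>{0..<T}. rho' t = rho t \<and> (\<forall>i\<in>{1..n}. lam' i t = lam i t)"
    by (simp add: lam'_def rho'_def)
  ultimately show ?thesis using e by (intro exI[of _ "T + e"]) auto
qed

section \<open>Wronskians, ratios and mass conservation for a maximal solution\<close>

locale maximal_flow =
  fixes n :: nat and k cb rho0 tB :: real
    and lam0 :: "nat \<Rightarrow> real" and lam :: "nat \<Rightarrow> real \<Rightarrow> real" and rho :: "real \<Rightarrow> real"
  assumes n: "2 \<le> n" and k: "0 < k" and cb: "0 < cb" and rho0: "0 < rho0"
    and maximal: "maximal_solution n k cb rho0 lam0 tB lam rho"
    and lam0_min: "\<And>i. i \<in> {1..n} \<Longrightarrow> lam0 1 \<le> lam0 i"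
begin

abbreviation u :: "nat \<Rightarrow> real \<Rightarrow> real" where "u \<equiv> u_fun lam"

definition \<kappa> :: real where "\<kappa> = k / real n"

lemma \<kappa>_pos: "0 < \<kappa>" using k n by (simp add: \<kappa>_def)

lemma
  shows tB_pos: "0 < tB" and rho_init: "rho 0 = rho0"
    and lam_init: "i \<in> {1..n} \<Longrightarrow> lam i 0 = lam0 i"
    and der_lam: "i \<in> {1..n} \<Longrightarrow> t \<in> {0..<tB} \<Longrightarrow>
      (lam i has_real_derivative - (lam i t)\<^sup>2 + \<kappa> * (rho t - cb)) (at t within {0..<tB})"
    and der_rho: "t \<in> {0..<tB} \<Longrightarrow>
      (rho has_real_derivative - rho t * (\<Sum>i=1..n. lam i t)) (at t within {0..<tB})"
  using maximal by (auto simp: maximal_solution_def is_solution_def \<kappa>_def)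

lemma u_pos [simp]: "0 < u i t" by (simp add: u_fun_def)

lemma u_neq0 [simp]: "u i t \<noteq> 0" using u_pos[of i t] by linarith

lemma u_0: "u i 0 = 1" by (simp add: u_fun_def)

lemma der_integral_lam:
  assumes "i \<in> {1..n}" "t \<in> {0..<tB}"
  shows "((\<lambda>t. integral {0..t} (lam i)) has_real_derivative lam i t) (at t within {0..<tB})"
proof -
  obtain b where b: "t < b" "b < tB" using dense[of t tB] assms by auto
  have "continuous_on {0..<tB} (lam i)"
    by (rule DERIV_continuous_on[OF der_lam[OF assms(1)]])
  then have "continuous_on {0..b} (lam i)" by (rule continuous_on_subset) (use b in auto)
  then have "((\<lambda>t. integral {0..t} (lam i)) has_real_derivative lam i t) (at t within {0..b})"
    using b assms by (intro integral_has_real_derivative) auto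
  moreover have "at t within {0..<tB} = at t within {0..b}"
    by (rule at_within_nhd[of _ "{..<b}"]) (use b in auto)
  ultimately show ?thesis by simp
qed

lemma der_u:
  assumes "i \<in> {1..n}" "t \<in> {0..<tB}"
  shows "(u i has_real_derivative lam i t * u i t) (at t within {0..<tB})"
  unfolding u_fun_def[abs_def]
  by (rule derivative_eq_intros der_integral_lam[OF assms] refl)+ simp

lemma const_of_zero_deriv:
  assumes "\<And>t. t \<in> {0..<tB} \<Longrightarrow> (f has_real_derivative 0) (at t within {0..<tB})" "t \<in> {0..<tB}"
  shows "f t = f 0"
  using has_field_derivative_zero_constant[of "{0..<tB}" f] assms tB_pos by force

text \<open>\<open>u i\<close> and \<open>u j\<close> solve the same linear equation, and this
  expression is their Wronskian \<open>u i * u j' - u i' * u j\<close>; in its derivative the common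
  term \<open>\<kappa> * (rho - cb)\<close> cancels.\<close>

lemma wronskian:
  assumes i: "i \<in> {1..n}" and j: "j \<in> {1..n}" and t: "t \<in> {0..<tB}"
  shows "u i t * u j t * (lam j t - lam i t) = lam0 j - lam0 i"
proof -
  have "u i t * u j t * (lam j t - lam i t) = u i 0 * u j 0 * (lam j 0 - lam i 0)"
  proof (rule const_of_zero_deriv[OF _ t])
    fix t assume t: "t \<in> {0..<tB}"
    show "((\<lambda>t. u i t * u j t * (lam j t - lam i t)) has_real_derivative 0) (at t within {0..<tB})"
      by (rule derivative_eq_intros der_u[OF i t] der_u[OF j t] der_lam[OF i t] der_lam[OF j t] refl)+
        (simp add: algebra_simps power2_eq_square)
  qed
  then show ?thesis using lam_init i j by (simp add: u_0)
qed

lemma lam_mono: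
  assumes "i \<in> {1..n}" "j \<in> {1..n}" "t \<in> {0..<tB}" "lam0 i \<le> lam0 j"
  shows "lam i t \<le> lam j t"
proof -
  have "0 \<le> u i t * u j t * (lam j t - lam i t)" using wronskian[OF assms(1-3)] assms(4) by simp
  moreover have "0 < u i t * u j t" by simp
  ultimately show ?thesis by (simp only: zero_le_mult_iff) auto
qed

lemma der_ratio:
  assumes i: "i \<in> {1..n}" and j: "j \<in> {1..n}" and t: "t \<in> {0..<tB}"
  shows "((\<lambda>t. u j t / u i t) has_real_derivative (lam0 j - lam0 i) / (u i t)\<^sup>2) (at t within {0..<tB})"
proof (rule DERIV_cong[OF DERIV_divide[OF der_u[OF j t] der_u[OF i t]]])
  show "(lam j t * u j t * u i t - u j t * (lam i t * u i t)) / (u i t * u i t)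
    = (lam0 j - lam0 i) / (u i t)\<^sup>2"
    unfolding wronskian[OF i j t, symmetric] by (simp add: power2_eq_square algebra_simps)
qed simp

lemma ratio_mono:
  assumes i: "i \<in> {1..n}" and j: "j \<in> {1..n}" and "0 \<le> s" "s \<le> t" "t < tB" and "lam0 i \<le> lam0 j"
  shows "u j s / u i s \<le> u j t / u i t"
proof -
  have "0 * (t - s) \<le> u j t / u i t - u j s / u i s"
    by (rule diff_ge_deriv_bound[OF _ DERIV_subset[OF der_ratio[OF i j]]]) (use assms in auto)
  then show ?thesis by simp
qed

lemma u_mono:
  assumes "i \<in> {1..n}" "j \<in> {1..n}" "t \<in> {0..<tB}" "lam0 i \<le> lam0 j"
  shows "u i t \<le> u j t"
proof -
  have "u j 0 / u i 0 \<le> u j t / u i t" using assms by (intro ratio_mono) auto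
  then show ?thesis by (simp add: u_0 le_divide_eq)
qed

lemma der_prod_u:
  assumes "A \<subseteq> {1..n}" "t \<in> {0..<tB}"
  shows "((\<lambda>t. \<Prod>i\<in>A. u i t) has_real_derivative (\<Prod>i\<in>A. u i t) * (\<Sum>i\<in>A. lam i t)) (at t within {0..<tB})"
proof -
  have "finite A" using assms finite_subset by blast
  then show ?thesis using assms(1)
  proof induction
    case (insert i A)
    then have "((\<lambda>t. u i t * (\<Prod>i\<in>A. u i t)) has_real_derivative
        lam i t * u i t * (\<Prod>i\<in>A. u i t) + (\<Prod>i\<in>A. u i t) * (\<Sum>i\<in>A. lam i t) * u i t) (at t within {0..<tB})"
      using assms by (intro DERIV_mult der_u) auto
    then show ?case using insert by (simp add: algebra_simps)
  qed simp
qed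

lemma mass_conservation:
  assumes t: "t \<in> {0..<tB}"
  shows "rho t * (\<Prod>i=1..n. u i t) = rho0"
proof -
  have "rho t * (\<Prod>i=1..n. u i t) = rho 0 * (\<Prod>i=1..n. u i 0)"
  proof (rule const_of_zero_deriv[OF _ t])
    fix t assume t: "t \<in> {0..<tB}"
    show "((\<lambda>t. rho t * (\<Prod>i=1..n. u i t)) has_real_derivative 0) (at t within {0..<tB})"
      by (rule DERIV_cong[OF DERIV_mult[OF der_rho[OF t] der_prod_u[OF subset_refl t]]])
        (simp add: algebra_simps)
  qed
  then show ?thesis by (simp add: rho_init u_0)
qed

lemma prod_u_pos: "0 < (\<Prod>i\<in>A. u i t)" for t by (simp add: prod_pos)

lemma rho_eq: "t \<in> {0..<tB} \<Longrightarrow> rho t = rho0 / (\<Prod>i=1..n. u i t)"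
  using mass_conservation[of t] prod_u_pos[where A = "{1..n}" and t = t] by (simp add: field_simps)

lemma rho_pos: "t \<in> {0..<tB} \<Longrightarrow> 0 < rho t"
  using rho0 prod_u_pos[where A = "{1..n}" and t = t] by (simp add: rho_eq)

text \<open>If \<open>u 1\<close> stayed away from 0, then so would all \<open>u i\<close>, the density would be bounded, and the
  linear equation for \<open>u 1\<close> would bound the eigenvalues, so that the solution could be continued.\<close>

lemma u1_not_bounded_below:
  assumes "0 < \<delta>" and \<delta>: "\<And>t. t \<in> {0..<tB} \<Longrightarrow> \<delta> \<le> u 1 t"
  shows False
proof -
  have n1: "1 \<in> {1..n}" using n by simp
  define r where "r = rho0 / \<delta> ^ n"
  have r: "rho t \<le> r" if t: "t \<in> {0..<tB}" for t
  proof -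
    have "(\<Prod>i=1..n. \<delta>) \<le> (\<Prod>i=1..n. u i t)"
      using u_mono[OF n1 _ t lam0_min] \<delta>[OF t] \<open>0 < \<delta>\<close>
      by (intro prod_mono) (force intro: order_trans)
    then show ?thesis
      unfolding r_def rho_eq[OF t] using rho0 \<open>0 < \<delta>\<close> prod_u_pos[where A = "{1..n}" and t = t]
      by (intro divide_left_mono) auto
  qed
  have r0: "0 \<le> r" using rho0 \<open>0 < \<delta>\<close> by (simp add: r_def)
  define S where "S = (\<Sum>i=1..n. \<bar>lam0 i\<bar>)"
  have S: "\<bar>lam0 i\<bar> \<le> S" if "i \<in> {1..n}" for i
    unfolding S_def using that by (intro member_le_sum) auto
  have S0: "0 \<le> S" unfolding S_def by (intro sum_nonneg) auto
  \<comment> \<open>Dropping the nonpositive square from the Riccati equation leaves a derivative of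
    at most \<open>\<kappa> * r\<close>, which bounds every eigenvalue by \<open>L\<close> from
    above.\<close>
  define L where "L = S + \<kappa> * r * tB"
  have L0: "0 \<le> L" using S0 r0 \<kappa>_pos tB_pos by (simp add: L_def)
  have up: "lam i t \<le> L" if i: "i \<in> {1..n}" and t: "t \<in> {0..<tB}" for i t
  proof -
    have "lam i t - lam i 0 \<le> \<kappa> * r * (t - 0)"
    proof (rule diff_le_deriv_bound[OF _ DERIV_subset[OF der_lam[OF i]]])
      fix s assume "0 \<le> s" "s \<le> t"
      then have "rho s - cb \<le> r" using r[of s] cb t by auto
      then have "\<kappa> * (rho s - cb) \<le> \<kappa> * r" using \<kappa>_pos by simp
      then show "- (lam i s)\<^sup>2 + \<kappa> * (rho s - cb) \<le> \<kappa> * r"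
        using zero_le_power2[of "lam i s"] by linarith
    qed (use t in auto)
    also have "\<dots> \<le> \<kappa> * r * tB" using \<kappa>_pos r0 t by (intro mult_left_mono) auto
    finally show ?thesis using S[OF i] lam_init[OF i] by (simp add: L_def)
  qed
  have u1_le: "u 1 t \<le> exp (L * tB)" if t: "t \<in> {0..<tB}" for t
  proof -
    have "integral {0..t} (lam 1) - integral {0..0} (lam 1) \<le> L * (t - 0)"
      by (rule diff_le_deriv_bound[OF _ DERIV_subset[OF der_integral_lam[OF n1]]])
        (use t up n1 in auto)
    also have "\<dots> \<le> L * tB" using L0 t by (intro mult_left_mono) auto
    finally show ?thesis by (simp add: u_fun_def)
  qed
  \<comment> \<open>The square prevents the same argument from below. Instead
    \<open>u 1' = lam 1 * u 1\<close> has derivative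
    \<open>\<kappa> * (rho - cb) * u 1 \<ge> - C\<close>, so it is at least \<open>- K\<close>, and
    dividing by \<open>u 1 \<ge> \<delta>\<close> bounds \<open>lam 1\<close>, the smallest
    eigenvalue.\<close>
  define C where "C = \<kappa> * cb * exp (L * tB)"
  define K where "K = S + C * tB"
  have K0: "0 \<le> K" using S0 \<kappa>_pos cb tB_pos by (simp add: K_def C_def)
  have lo1: "- (K / \<delta>) \<le> lam 1 t" if t: "t \<in> {0..<tB}" for t
  proof -
    have "(- C) * (t - 0) \<le> lam 1 t * u 1 t - lam 1 0 * u 1 0"
    proof (rule diff_ge_deriv_bound)
      fix s assume s: "0 \<le> s" "s \<le> t"
      then have s': "s \<in> {0..<tB}" using t by auto
      show "((\<lambda>t. lam 1 t * u 1 t) has_real_derivative \<kappa> * (rho s - cb) * u 1 s) (at s within {0..t})"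
      proof (rule DERIV_subset)
        show "((\<lambda>t. lam 1 t * u 1 t) has_real_derivative \<kappa> * (rho s - cb) * u 1 s) (at s within {0..<tB})"
          by (rule DERIV_cong[OF DERIV_mult[OF der_lam[OF n1 s'] der_u[OF n1 s']]])
            (simp add: algebra_simps power2_eq_square)
      qed (use t in auto)
      have "\<kappa> * cb * u 1 s \<le> C"
        unfolding C_def using u1_le[OF s'] \<kappa>_pos cb by (intro mult_left_mono) auto
      moreover have "- (\<kappa> * cb * u 1 s) \<le> \<kappa> * (rho s - cb) * u 1 s"
        using rho_pos[OF s'] \<kappa>_pos less_imp_le[OF u_pos[of 1 s]] by (simp add: algebra_simps)
      ultimately show "- C \<le> \<kappa> * (rho s - cb) * u 1 s" by linarith
    qed (use t in auto)
    moreover have "C * t \<le> C * tB"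
      using t \<kappa>_pos cb by (intro mult_left_mono) (auto simp: C_def)
    moreover have "- S \<le> lam 1 0" using S[OF n1] lam_init[OF n1] by simp
    ultimately have "- K \<le> lam 1 t * u 1 t" by (simp add: K_def u_0)
    then have "- K / u 1 t \<le> lam 1 t" by (simp only: pos_divide_le_eq[OF u_pos])
    moreover have "K / u 1 t \<le> K / \<delta>"
      using \<delta>[OF t] \<open>0 < \<delta>\<close> K0 by (intro divide_left_mono) auto
    ultimately show ?thesis by simp
  qed
  have "\<exists>T' lam' rho'. tB < T' \<and> is_solution n k cb rho0 lam0 T' lam' rho' \<and>
    (\<forall>t\<in>{0..<tB}. rho' t = rho t \<and> (\<forall>i\<in>{1..n}. lam' i t = lam i t))"
  proof (rule bounded_solution_extends)
    show "is_solution n k cb rho0 lam0 tB lam rho"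
      using maximal by (simp add: maximal_solution_def)
    show "\<bar>lam i t\<bar> \<le> max r (max L (K / \<delta>))" if "i \<in> {1..n}" "t \<in> {0..<tB}" for i t
      using up[OF that] lo1[OF that(2)] lam_mono[OF n1 that lam0_min[OF that(1)]]
      by (auto simp: abs_le_iff le_max_iff_disj)
    show "\<bar>rho t\<bar> \<le> max r (max L (K / \<delta>))" if "t \<in> {0..<tB}" for t
      using r[OF that] rho_pos[OF that] by auto
  qed
  then show False using maximal by (auto simp: maximal_solution_def)
qed

end

text \<open>The inverse \<open>\<sigma>\<close> of the strictly increasing, unbounded new time
  \<open>S\<close> has derivative \<open>1 / S' = P\<close>. Restricting to \<open>s > S a\<close>
  keeps \<open>\<sigma> s\<close> off the endpoint \<open>a\<close>, so that the derivatives are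
  two-sided.\<close>

lemma time_change:
  fixes S P :: "real \<Rightarrow> real"
  assumes "a < b"
    and der: "\<And>t. a \<le> t \<Longrightarrow> t < b \<Longrightarrow> (S has_real_derivative 1 / P t) (at t)"
    and P: "\<And>t. a \<le> t \<Longrightarrow> t < b \<Longrightarrow> 0 < P t"
    and S: "filterlim S at_top (at_left b)"
  shows "\<exists>\<sigma>. (\<forall>t. a \<le> t \<longrightarrow> t < b \<longrightarrow> \<sigma> (S t) = t) \<and>
    (\<forall>s > S a. a < \<sigma> s \<and> \<sigma> s < b \<and> (\<sigma> has_real_derivative P (\<sigma> s)) (at s)) \<and>
    filterlim \<sigma> (at_left b) at_top"
proof -
  have strict: "S x < S y" if "a \<le> x" "x < y" "y < b" for x y
    using DERIV_pos_imp_increasing[of x y S] der P that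
    by (metis less_eq_real_def order_less_le_trans order_trans zero_less_divide_1_iff)
  have le: "x \<le> y" if "S x \<le> S y" "a \<le> y" "x < b" for x y
    using that strict[of y x] by force
  have ex: "\<exists>t. a \<le> t \<and> t < b \<and> S t = s" if s: "S a \<le> s" for s
  proof -
    have "\<forall>\<^sub>F t in at_left b. s \<le> S t" using S by (simp add: filterlim_at_top)
    from eventually_happens'[OF _ eventually_conj[OF this eventually_at_left_real[OF \<open>a < b\<close>]]]
    obtain t where t: "s \<le> S t" "a < t" "t < b" by auto
    have "continuous_on {a..t} S"
      by (intro continuous_at_imp_continuous_on ballI DERIV_isCont[OF der]) (use t in auto)
    then obtain x where "a \<le> x" "x \<le> t" "S x = s"
      using IVT'[of S a s t] s t by auto
    then show ?thesis using t by auto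
  qed
  define \<sigma> where "\<sigma> = inv_into {a..<b} S"
  have inj: "inj_on S {a..<b}"
    by (rule inj_onI) (metis atLeastLessThan_iff le order_antisym order_refl)
  have \<sigma>S: "\<sigma> (S t) = t" if "a \<le> t" "t < b" for t
    unfolding \<sigma>_def using that inj by (intro inv_into_f_f) auto
  have \<sigma>: "a < \<sigma> s" "\<sigma> s < b" "S (\<sigma> s) = s" if s: "S a < s" for s
  proof -
    obtain t where t: "a \<le> t" "t < b" "S t = s" using ex[of s] s by auto
    then have "\<sigma> s = t" using \<sigma>S by auto
    then show "a < \<sigma> s" "\<sigma> s < b" "S (\<sigma> s) = s" using t s by (auto simp: less_le)
  qed
  have d\<sigma>: "(\<sigma> has_real_derivative P (\<sigma> s)) (at s)" if s: "S a < s" for s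
  proof -
    note \<sigma>s = \<sigma>[OF s]
    obtain c where c: "\<sigma> s < c" "c < b" using dense \<sigma>s by blast
    have cont: "isCont \<sigma> (S (\<sigma> s))"
      by (rule isCont_inverse_function2[of a _ c])
        (use \<sigma>s c in \<open>auto intro: \<sigma>S DERIV_isCont[OF der]\<close>)
    have "(\<sigma> has_real_derivative inverse (1 / P (\<sigma> s))) (at s)"
    proof (rule DERIV_inverse_function[where f = S and a = "S a" and b = "s + 1"])
      show "(S has_real_derivative 1 / P (\<sigma> s)) (at (\<sigma> s))" using der \<sigma>s by simp
      show "1 / P (\<sigma> s) \<noteq> 0" using P[of "\<sigma> s"] \<sigma>s by simp
    qed (use s \<sigma> cont \<sigma>s in auto)
    then show ?thesis by simp
  qed
  have "filterlim \<sigma> (at_left b) at_top"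
    unfolding filterlim_at
  proof
    show "(\<sigma> \<longlongrightarrow> b) at_top"
    proof (rule increasing_tendsto)
      show "\<forall>\<^sub>F s in at_top. \<sigma> s \<le> b"
        using eventually_gt_at_top[of "S a"] by eventually_elim (intro less_imp_le \<sigma>)
      fix y assume "y < b"
      define z where "z = (max a y + b) / 2"
      have z: "a \<le> z" "y < z" "z < b" using \<open>y < b\<close> \<open>a < b\<close> by (auto simp: z_def)
      show "\<forall>\<^sub>F s in at_top. y < \<sigma> s"
        using eventually_gt_at_top[of "max (S a) (S z)"]
      proof eventually_elim
        case (elim s)
        then have s: "S a < s" "S z < s" by auto
        have "z \<le> \<sigma> s" by (rule le) (use \<sigma>[OF s(1)] s z in auto)
        then show ?case using z by simp
      qed
    qed
    show "\<forall>\<^sub>F s in at_top. \<sigma> s \<in> {..<b} \<and> \<sigma> s \<noteq> b"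
      using eventually_gt_at_top[of "S a"]
    proof eventually_elim
      case (elim s)
      then show ?case using \<sigma>(2)[of s] by simp
    qed
  qed
  with \<sigma>S \<sigma> d\<sigma> show ?thesis by blast
qed

section \<open>Comparison with a trigonometric solution and decay of \<open>u 1\<close>\<close>

context maximal_flow
begin

definition \<omega> :: real where "\<omega> = sqrt (\<kappa> * cb)"

text \<open>After \<open>t0\<close> the angle \<open>\<omega> * (tB - t)\<close> lies in
  \<open>[0, 1]\<close>, where the cosine is at least \<open>cos 1 > 0\<close> and the sine is
  nonnegative. The entry \<open>tB / 2\<close> keeps \<open>t0\<close> positive, so that these times
  are interior and carry two-sided derivatives.\<close>

definition t0 :: real where "t0 = max (tB / 2) (tB - 1 / \<omega>)"

text \<open>Since \<open>u'' = \<kappa> * (rho - cb) * u\<close> and \<open>\<phi>'' = - \<kappa> * cb * \<phi>\<close>, dividing by \<open>\<phi>\<close> removes the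
  negative part of the coefficient: \<open>v i = u i / \<phi>\<close> is convex in the time variable with
  differential \<open>dt / \<phi>\<^sup>2\<close>, and \<open>V i\<close> is its derivative with respect to that time.\<close>

definition \<phi> :: "real \<Rightarrow> real" where "\<phi> t = cos (\<omega> * (tB - t))"

definition \<psi> :: "real \<Rightarrow> real" where "\<psi> t = \<omega> * sin (\<omega> * (tB - t))"

definition v :: "nat \<Rightarrow> real \<Rightarrow> real" where "v i t = u i t / \<phi> t"

definition V :: "nat \<Rightarrow> real \<Rightarrow> real" where "V i t = lam i t * u i t * \<phi> t - u i t * \<psi> t"

lemma \<omega>_pos: "0 < \<omega>" using \<kappa>_pos cb by (simp add: \<omega>_def)

lemma \<omega>_sq: "\<omega> * \<omega> = \<kappa> * cb" using \<kappa>_pos cb by (simp add: \<omega>_def)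

lemma t0: "0 < t0" "t0 < tB" using tB_pos \<omega>_pos by (auto simp: t0_def less_max_iff_disj)

lemma late: "t \<in> {t0..<tB} \<Longrightarrow> t \<in> {0..<tB}" using t0 by auto

lemma n1: "1 \<in> {1..n}" using n by simp

lemma angle:
  assumes "t \<in> {t0..<tB}"
  shows "0 \<le> \<omega> * (tB - t)" "\<omega> * (tB - t) \<le> 1"
proof -
  show "0 \<le> \<omega> * (tB - t)" using assms \<omega>_pos by auto
  have "tB - t \<le> 1 / \<omega>" using assms by (auto simp: t0_def)
  then show "\<omega> * (tB - t) \<le> 1" using \<omega>_pos by (simp add: field_simps)
qed

lemma cos1_pos: "0 < cos (1::real)" using pi_gt3 by (intro cos_gt_zero_pi) auto

lemma \<phi>_bounds:
  assumes "t \<in> {t0..<tB}"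
  shows "cos 1 \<le> \<phi> t" "0 < \<phi> t" "\<phi> t \<le> 1"
proof -
  show "cos 1 \<le> \<phi> t"
    unfolding \<phi>_def using angle[OF assms] pi_gt3 by (intro cos_monotone_0_pi_le) auto
  then show "0 < \<phi> t" using cos1_pos by linarith
qed (simp add: \<phi>_def)

lemma \<psi>_nonneg: "t \<in> {t0..<tB} \<Longrightarrow> 0 \<le> \<psi> t"
  unfolding \<psi>_def using angle[of t] \<omega>_pos pi_gt3 by (intro mult_nonneg_nonneg sin_ge_zero) auto

lemma der_\<phi>: "(\<phi> has_real_derivative \<psi> t) (at t)"
  unfolding \<phi>_def[abs_def] \<psi>_def
  by (rule derivative_eq_intros refl | simp)+

lemma der_\<psi>: "(\<psi> has_real_derivative - \<kappa> * cb * \<phi> t) (at t)"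
  unfolding \<psi>_def[abs_def] \<phi>_def minus_mult_left[symmetric] \<omega>_sq[symmetric]
  by (rule derivative_eq_intros refl | simp)+

lemma \<phi>_lim: "(\<phi> \<longlongrightarrow> 1) (at_left tB)"
proof -
  have "(\<phi> \<longlongrightarrow> cos (\<omega> * (tB - tB))) (at_left tB)"
    unfolding \<phi>_def[abs_def] by (intro tendsto_intros)
  then show ?thesis by simp
qed

lemma \<psi>_lim: "(\<psi> \<longlongrightarrow> 0) (at_left tB)"
proof -
  have "(\<psi> \<longlongrightarrow> \<omega> * sin (\<omega> * (tB - tB))) (at_left tB)"
    unfolding \<psi>_def[abs_def] by (intro tendsto_intros)
  then show ?thesis by simp
qed

lemma eventually_late:
  assumes "t1 < tB"
  shows "\<forall>\<^sub>F t in at_left tB. t1 \<le> t \<and> t < tB \<and> t \<in> {t0..<tB}"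
proof -
  have "max t1 t0 < tB" using assms t0 by simp
  from eventually_at_left_real[OF this] show ?thesis by eventually_elim auto
qed

lemma at_late: "t \<in> {t0..<tB} \<Longrightarrow> at t within {0..<tB} = at t"
  using t0 by (intro at_within_interior) auto

lemma der_u_at: "i \<in> {1..n} \<Longrightarrow> t \<in> {t0..<tB} \<Longrightarrow> (u i has_real_derivative lam i t * u i t) (at t)"
  using der_u[of i t] at_late[of t] late[of t] by simp

lemma der_lam_at: "i \<in> {1..n} \<Longrightarrow> t \<in> {t0..<tB} \<Longrightarrow>
    (lam i has_real_derivative - (lam i t)\<^sup>2 + \<kappa> * (rho t - cb)) (at t)"
  using der_lam[of i t] at_late[of t] late[of t] by simp

text \<open>\<open>V i\<close> is the Wronskian \<open>\<phi> * u i' - \<phi>' * u i\<close>. Since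
  \<open>\<phi>\<close> solves the equation without the density, only the term with
  \<open>rho\<close> survives, and it is positive.\<close>

lemma der_V:
  assumes "i \<in> {1..n}" "t \<in> {t0..<tB}"
  shows "(V i has_real_derivative \<kappa> * rho t * u i t * \<phi> t) (at t)"
  unfolding V_def[abs_def]
  by (rule derivative_eq_intros der_u_at[OF assms] der_lam_at[OF assms] der_\<phi> der_\<psi> refl)+
    (simp add: algebra_simps power2_eq_square)

lemma der_v:
  assumes "i \<in> {1..n}" "t \<in> {t0..<tB}"
  shows "(v i has_real_derivative V i t / (\<phi> t)\<^sup>2) (at t)"
  unfolding v_def[abs_def]
  by (rule DERIV_cong[OF DERIV_divide[OF der_u_at[OF assms] der_\<phi>]])
    (use \<phi>_bounds[OF assms(2)] in \<open>auto simp: V_def power2_eq_square algebra_simps\<close>)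

lemma v_pos: "t \<in> {t0..<tB} \<Longrightarrow> 0 < v i t" using \<phi>_bounds[of t] by (simp add: v_def)

lemma u_eq_v: "t \<in> {t0..<tB} \<Longrightarrow> u i t = v i t * \<phi> t" using \<phi>_bounds[of t] by (simp add: v_def)

lemma V_mono:
  assumes "i \<in> {1..n}" "t0 \<le> s" "s \<le> t" "t < tB"
  shows "V i s \<le> V i t"
proof -
  have "0 * (t - s) \<le> V i t - V i s"
  proof (rule diff_ge_deriv_bound[OF _ has_field_derivative_at_within[OF der_V]])
    show "0 \<le> \<kappa> * rho x * u i x * \<phi> x" if "s \<le> x" "x \<le> t" for x
      using \<kappa>_pos rho_pos[of x] \<phi>_bounds[of x] t0 that assms less_imp_le[OF u_pos[of i x]]
      by (intro mult_nonneg_nonneg) auto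
  qed (use assms in auto)
  then show ?thesis by simp
qed

lemma v_mono:
  assumes "i \<in> {1..n}" "t0 \<le> s" "s \<le> t" "t < tB" "0 \<le> V i s"
  shows "v i s \<le> v i t"
proof -
  have "0 * (t - s) \<le> v i t - v i s"
  proof (rule diff_ge_deriv_bound[OF _ has_field_derivative_at_within[OF der_v]])
    show "0 \<le> V i x / (\<phi> x)\<^sup>2" if "s \<le> x" "x \<le> t" for x
      using V_mono[of i s x] that assms by simp
  qed (use assms in auto)
  then show ?thesis by simp
qed

lemma v_antimono:
  assumes "i \<in> {1..n}" "t0 \<le> s" "s \<le> t" "t < tB"
    and V: "\<And>x. x \<in> {t0..<tB} \<Longrightarrow> V i x \<le> 0"
  shows "v i t \<le> v i s"
proof -
  have "v i t - v i s \<le> 0 * (t - s)"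
  proof (rule diff_le_deriv_bound[OF _ has_field_derivative_at_within[OF der_v]])
    show "V i x / (\<phi> x)\<^sup>2 \<le> 0" if "s \<le> x" "x \<le> t" for x
      using V[of x] that assms by (simp add: divide_nonpos_nonneg)
  qed (use assms in auto)
  then show ?thesis by simp
qed

text \<open>On the compact interval \<open>{0..t1}\<close> the positive continuous
  \<open>u 1\<close> has a positive minimum, so a late lower bound extends to all times.\<close>

lemma u1_not_eventually_bounded_below:
  assumes t1: "t1 \<in> {t0..<tB}" and "0 < c" and c: "\<And>t. t1 \<le> t \<Longrightarrow> t < tB \<Longrightarrow> c \<le> u 1 t"
  shows False
proof -
  have t1': "0 \<le> t1" "t1 < tB" using late[OF t1] by auto
  have "continuous_on {0..<tB} (u 1)" by (rule DERIV_continuous_on[OF der_u[OF n1]])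
  then have "continuous_on {0..t1} (u 1)"
    by (rule continuous_on_subset) (use t1' in auto)
  then obtain x where x: "x \<in> {0..t1}" "\<And>t. t \<in> {0..t1} \<Longrightarrow> u 1 x \<le> u 1 t"
    using continuous_attains_inf[of "{0..t1}" "u 1"] t1' by auto
  show False
  proof (rule u1_not_bounded_below)
    show "0 < min c (u 1 x)" using \<open>0 < c\<close> by simp
    show "min c (u 1 x) \<le> u 1 t" if "t \<in> {0..<tB}" for t
      using c[of t] x(2)[of t] that by (cases "t \<le> t1") (auto simp: min_le_iff_disj)
  qed
qed

lemma v1_not_eventually_bounded_below:
  assumes t1: "t1 \<in> {t0..<tB}" and "0 < c" and c: "\<And>t. t1 \<le> t \<Longrightarrow> t < tB \<Longrightarrow> c \<le> v 1 t"
  shows False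
proof (rule u1_not_eventually_bounded_below[OF t1])
  show "0 < c * cos 1" using \<open>0 < c\<close> cos1_pos by simp
  fix t assume t: "t1 \<le> t" "t < tB"
  then have "t \<in> {t0..<tB}" using t1 by auto
  then show "c * cos 1 \<le> u 1 t"
    unfolding u_eq_v[OF \<open>t \<in> _\<close>] using c[OF t] \<open>0 < c\<close> \<phi>_bounds cos1_pos by (intro mult_mono) auto
qed

text \<open>Once positive, \<open>V 1\<close> stays positive and \<open>v 1\<close> no longer
  decreases, which keeps \<open>u 1\<close> away from 0 and contradicts maximality.\<close>

lemma V1_nonpos: "V 1 t \<le> 0" if t: "t \<in> {t0..<tB}"
proof (rule ccontr)
  assume "\<not> V 1 t \<le> 0"
  then have "v 1 t \<le> v 1 x" if "t \<le> x" "x < tB" for x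
    using that t n1 by (intro v_mono) auto
  then show False using v1_not_eventually_bounded_below[OF t v_pos[OF t]] by blast
qed

lemma v1_lim: "(v 1 \<longlongrightarrow> 0) (at_left tB)"
proof -
  obtain l where l: "(v 1 \<longlongrightarrow> l) (at_left tB)" "\<forall>x\<in>{t0..<tB}. l \<le> v 1 x"
    using antimono_tendsto_at_left[of t0 tB "v 1" 0] t0 v_antimono[OF n1 _ _ _ V1_nonpos]
      less_imp_le[OF v_pos] by auto
  have "0 \<le> l"
    by (rule tendsto_lowerbound[OF l(1)])
      (use eventually_late[OF t0(2)] in \<open>auto elim!: eventually_mono intro: less_imp_le[OF v_pos]\<close>)
  moreover have "\<not> 0 < l"
    using v1_not_eventually_bounded_below[of t0 l] l(2) t0 by auto
  ultimately show ?thesis using l(1) by simp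
qed

lemma u1_lim: "(u 1 \<longlongrightarrow> 0) (at_left tB)"
proof (rule Lim_transform_eventually)
  show "((\<lambda>t. v 1 t * \<phi> t) \<longlongrightarrow> 0) (at_left tB)"
    using tendsto_mult[OF v1_lim \<phi>_lim] by simp
  show "\<forall>\<^sub>F t in at_left tB. v 1 t * \<phi> t = u 1 t"
    using eventually_late[OF t0(2)] by eventually_elim (simp add: u_eq_v)
qed

lemma tendsto_mult_bounded_v1:
  assumes "\<And>t. t \<in> {t0..<tB} \<Longrightarrow> \<bar>f t\<bar> \<le> C"
  shows "((\<lambda>t. v 1 t * f t) \<longlongrightarrow> 0) (at_left tB)"
proof (rule Lim_null_comparison)
  show "((\<lambda>t. v 1 t * C) \<longlongrightarrow> 0) (at_left tB)"
    using tendsto_mult[OF v1_lim tendsto_const[of C]] by simp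
  show "\<forall>\<^sub>F t in at_left tB. norm (v 1 t * f t) \<le> v 1 t * C"
    using eventually_late[OF t0(2)]
  proof eventually_elim
    case (elim t)
    then show ?case using assms[of t] v_pos[of t 1] by (simp add: abs_mult mult_left_mono)
  qed
qed

text \<open>\<open>V 1\<close> is monotone and nonpositive, hence bounded, while \<open>v 1\<close>
  tends to 0; the \<open>\<psi>\<close> term vanishes with \<open>u 1\<close>. The limit disposes of
  the \<open>u 1\<close> component when another \<open>u j\<close> is written as a
  combination.\<close>

lemma lam1_u1_sq_lim: "((\<lambda>t. lam 1 t * u 1 t * u 1 t) \<longlongrightarrow> 0) (at_left tB)"
proof (rule Lim_transform_eventually)
  have "\<bar>V 1 t\<bar> \<le> - V 1 t0" if "t \<in> {t0..<tB}" for t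
    using V1_nonpos[OF that] V_mono[OF n1, of t0 t] that by auto
  then have "((\<lambda>t. v 1 t * V 1 t) \<longlongrightarrow> 0) (at_left tB)" by (rule tendsto_mult_bounded_v1)
  moreover have "((\<lambda>t. u 1 t * u 1 t * (\<psi> t / \<phi> t)) \<longlongrightarrow> 0 * 0 * (0 / 1)) (at_left tB)"
    by (intro tendsto_intros u1_lim \<psi>_lim \<phi>_lim) simp
  ultimately show "((\<lambda>t. v 1 t * V 1 t + u 1 t * u 1 t * (\<psi> t / \<phi> t)) \<longlongrightarrow> 0) (at_left tB)"
    using tendsto_add by fastforce
  show "\<forall>\<^sub>F t in at_left tB. v 1 t * V 1 t + u 1 t * u 1 t * (\<psi> t / \<phi> t) = lam 1 t * u 1 t * u 1 t"
    using eventually_late[OF t0(2)]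
  proof eventually_elim
    case (elim t)
    then show ?case using \<phi>_bounds[of t] by (simp add: v_def V_def field_simps)
  qed
qed

subsection \<open>Pairs of eigenvalues\<close>

definition w :: "nat \<Rightarrow> real" where "w j = lam0 j - lam0 1"

definition P :: "nat \<Rightarrow> real \<Rightarrow> real" where "P j t = u 1 t * u j t"

text \<open>By \<open>\<beta>_eq\<close> this is \<open>- u 1' * u j\<close> plus
  \<open>P j * \<psi> / \<phi>\<close>, a correction that vanishes with \<open>P j\<close>. It makes
  the sign of \<open>\<beta>\<close> and its logistic equation exact.\<close>

definition \<beta> :: "nat \<Rightarrow> real \<Rightarrow> real" where "\<beta> j t = - V 1 t * v j t"

definition F :: "nat \<Rightarrow> real \<Rightarrow> real" where "F j t = \<kappa> * rho t * (P j t)\<^sup>2"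

lemma P_pos: "0 < P j t" by (simp add: P_def)

text \<open>Dividing both functions by \<open>\<phi>\<close> and passing to the time
  \<open>dt / \<phi>^2\<close> leaves the Wronskian unchanged, so
  \<open>v 1 * V j - V 1 * v j\<close> is still \<open>w j\<close>.\<close>

lemma wronskian_v:
  assumes "j \<in> {1..n}" "t \<in> {t0..<tB}"
  shows "w j - \<beta> j t = v 1 t * V j t"
  unfolding w_def wronskian[OF n1 assms(1) late[OF assms(2)], symmetric]
  using \<phi>_bounds[OF assms(2)] by (simp add: \<beta>_def v_def V_def field_simps)

lemma \<beta>_eq:
  assumes "t \<in> {t0..<tB}"
  shows "\<beta> j t = - (P j t * (lam 1 t - \<psi> t / \<phi> t))"
  using \<phi>_bounds[OF assms] by (simp add: \<beta>_def v_def V_def P_def field_simps)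

lemma P_lam_diff:
  assumes "j \<in> {1..n}" "t \<in> {t0..<tB}"
  shows "P j t * (lam j t - lam 1 t) = w j"
  using wronskian[OF n1 assms(1) late[OF assms(2)]] by (simp add: P_def w_def)

text \<open>The bracket is the logarithmic derivative of \<open>P j / \<phi>^2\<close>; it enters
  the growth rate of the weight in \<open>\<beta>_convergent_few_low\<close>.\<close>

lemma P_lam_sum:
  assumes "j \<in> {1..n}" "t \<in> {t0..<tB}"
  shows "P j t * (lam 1 t + lam j t - 2 * (\<psi> t / \<phi> t)) = w j - 2 * \<beta> j t"
  using P_lam_diff[OF assms] \<beta>_eq[OF assms(2), of j] by (simp add: algebra_simps)

lemma \<beta>_nonneg: "t \<in> {t0..<tB} \<Longrightarrow> 0 \<le> \<beta> j t"
  unfolding \<beta>_def using V1_nonpos[of t] v_pos[of t j] by (intro mult_nonneg_nonneg) auto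

text \<open>The product rule yields \<open>- V 1 * V j / \<phi>^2\<close>; expanding this fraction
  by \<open>v 1 * v j\<close> and using \<open>wronskian_v\<close> turns it into the logistic term,
  and the derivative of \<open>V 1\<close> gives the forcing. The common denominator
  \<open>P j\<close> suggests the time \<open>dt / P j\<close>.\<close>

lemma der_\<beta>:
  assumes j: "j \<in> {1..n}" and t: "t \<in> {t0..<tB}"
  shows "(\<beta> j has_real_derivative (\<beta> j t * (w j - \<beta> j t) - F j t) / P j t) (at t)"
proof -
  have "(\<beta> j has_real_derivative - (\<kappa> * rho t * u 1 t * \<phi> t) * v j t + V j t / (\<phi> t)\<^sup>2 * (- V 1 t)) (at t)"
    unfolding \<beta>_def[abs_def] by (intro DERIV_mult DERIV_minus der_V der_v n1 j t)
  moreover have "- (\<kappa> * rho t * u 1 t * \<phi> t) * v j t + V j t / (\<phi> t)\<^sup>2 * (- V 1 t)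
      = (\<beta> j t * (w j - \<beta> j t) - F j t) / P j t"
    unfolding wronskian_v[OF j t] using \<phi>_bounds[OF t]
    by (simp add: \<beta>_def F_def P_def v_def power2_eq_square field_simps)
  ultimately show ?thesis by simp
qed

text \<open>If \<open>v j\<close> never grows, then \<open>V j\<close> and \<open>v j\<close> are
  bounded, so their products with \<open>v 1\<close>, which are \<open>w j - \<beta> j\<close> and
  \<open>P j / \<phi>^2\<close>, tend to 0.\<close>

lemma limits_if_V_nonpos:
  assumes j: "j \<in> {1..n}" and V: "\<And>t. t \<in> {t0..<tB} \<Longrightarrow> V j t \<le> 0"
  shows "(\<beta> j \<longlongrightarrow> w j) (at_left tB)" "(P j \<longlongrightarrow> 0) (at_left tB)"
proof -
  have "\<bar>V j t\<bar> \<le> - V j t0" if "t \<in> {t0..<tB}" for t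
    using V[OF that] V_mono[OF j, of t0 t] that by auto
  then have "((\<lambda>t. w j - v 1 t * V j t) \<longlongrightarrow> w j - 0) (at_left tB)"
    by (intro tendsto_diff tendsto_const tendsto_mult_bounded_v1)
  moreover have "\<forall>\<^sub>F t in at_left tB. w j - v 1 t * V j t = \<beta> j t"
    using eventually_late[OF t0(2)]
  proof eventually_elim
    case (elim t)
    then show ?case using wronskian_v[OF j, of t] by simp
  qed
  ultimately show "(\<beta> j \<longlongrightarrow> w j) (at_left tB)"
    using Lim_transform_eventually by fastforce
  have "\<bar>v j t\<bar> \<le> v j t0" if "t \<in> {t0..<tB}" for t
    using v_antimono[OF j _ _ _ V, of t0 t] v_pos[OF that, of j] that by auto
  then have "((\<lambda>t. v 1 t * v j t * (\<phi> t)\<^sup>2) \<longlongrightarrow> 0 * 1\<^sup>2) (at_left tB)"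
    by (intro tendsto_intros tendsto_mult_bounded_v1 \<phi>_lim)
  moreover have "\<forall>\<^sub>F t in at_left tB. v 1 t * v j t * (\<phi> t)\<^sup>2 = P j t"
    using eventually_late[OF t0(2)]
    by eventually_elim (simp add: P_def u_eq_v power2_eq_square)
  ultimately show "(P j \<longlongrightarrow> 0) (at_left tB)"
    using Lim_transform_eventually by fastforce
qed

text \<open>The ratios \<open>u i / u 1\<close> and \<open>u j / u 1\<close> have the proportional
  derivatives \<open>w i / (u 1)^2\<close> and \<open>w j / (u 1)^2\<close>, so a fixed combination
  of them is constant; its value comes from time 0, where every \<open>u i\<close> is 1.\<close>

lemma u_combination:
  assumes i: "i \<in> {1..n}" and j: "j \<in> {1..n}" and "0 < w j" and t: "t \<in> {0..<tB}"
  shows "u i t = (1 - w i / w j) * u 1 t + w i / w j * u j t"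
proof -
  have "u i t / u 1 t - w i / w j * (u j t / u 1 t) = u i 0 / u 1 0 - w i / w j * (u j 0 / u 1 0)"
  proof (rule const_of_zero_deriv[OF _ t])
    fix t assume t: "t \<in> {0..<tB}"
    show "((\<lambda>t. u i t / u 1 t - w i / w j * (u j t / u 1 t)) has_real_derivative 0) (at t within {0..<tB})"
      by (rule DERIV_cong[OF DERIV_diff[OF der_ratio[OF n1 i t] DERIV_cmult[OF der_ratio[OF n1 j t]]]])
        (use \<open>0 < w j\<close> in \<open>simp add: w_def\<close>)
  qed
  moreover define r where "r = w i / w j"
  ultimately show ?thesis by (simp add: u_0 field_simps)
qed

end

section \<open>The first index above the minimum, once \<open>v j\<close> increases\<close>

locale expanding_pair = maximal_flow +
  fixes J j :: nat and t1 :: real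
  assumes J: "1 \<le> J" "j = J + 1" "j \<le> n"
    and low: "\<And>i. i \<in> {1..J} \<Longrightarrow> lam0 i = lam0 1"
    and gap: "lam0 1 < lam0 j"
    and high: "\<And>i. i \<in> {j..n} \<Longrightarrow> lam0 j \<le> lam0 i"
    and t1: "t1 \<in> {t0..<tB}" and V_t1: "0 < V j t1"
begin

lemma j: "j \<in> {1..n}" using J by auto

lemma w_pos: "0 < w j" using gap by (simp add: w_def)

lemma t1_less: "t1 < tB" using t1 by auto

lemma late1: "t1 \<le> t \<Longrightarrow> t < tB \<Longrightarrow> t \<in> {t0..<tB}" using t1 by auto

lemma V_pos: "t1 \<le> t \<Longrightarrow> t < tB \<Longrightarrow> 0 < V j t"
  using V_mono[OF j, of t1 t] V_t1 t1 by auto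

lemma vj_mono: "t1 \<le> s \<Longrightarrow> s \<le> t \<Longrightarrow> t < tB \<Longrightarrow> v j s \<le> v j t"
  using V_pos[of s] t1 by (intro v_mono j) auto

lemma \<beta>_le: "t1 \<le> t \<Longrightarrow> t < tB \<Longrightarrow> \<beta> j t \<le> w j"
  using wronskian_v[OF j late1[of t]] mult_pos_pos[OF v_pos[OF late1[of t], of 1] V_pos[of t]] by simp

definition c1 :: real where "c1 = v j t1 * cos 1"

lemma c1_pos: "0 < c1" using v_pos[OF t1] cos1_pos by (simp add: c1_def)

lemma uj_ge: "t1 \<le> t \<Longrightarrow> t < tB \<Longrightarrow> c1 \<le> u j t"
  unfolding c1_def u_eq_v[OF late1] using vj_mono[of t1 t] \<phi>_bounds[OF late1, of t] cos1_pos v_pos[OF late1, of t j]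
  by (intro mult_mono) auto

lemma ratio_lim: "filterlim (\<lambda>t. u j t / u 1 t) at_top (at_left tB)"
proof (rule filterlim_at_top_mono)
  have "filterlim (\<lambda>t. inverse (u 1 t)) at_top (at_left tB)"
    by (rule filterlim_inverse_at_top[OF u1_lim]) simp
  then show "filterlim (\<lambda>t. c1 * inverse (u 1 t)) at_top (at_left tB)"
    by (rule filterlim_tendsto_pos_mult_at_top[OF tendsto_const c1_pos])
  show "\<forall>\<^sub>F t in at_left tB. c1 * inverse (u 1 t) \<le> u j t / u 1 t"
    using eventually_late[OF t1_less]
    by eventually_elim (use uj_ge in \<open>simp add: divide_inverse mult_right_mono less_imp_le\<close>)
qed

text \<open>A primitive of \<open>1 / P j\<close> in closed form, because \<open>u j / u 1\<close>
  has derivative \<open>w j / (u 1)^2\<close>. It is unbounded because \<open>u 1\<close> tends to 0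
  while \<open>u j\<close> stays above \<open>c1\<close>.\<close>

definition S :: "real \<Rightarrow> real" where "S t = ln (u j t / u 1 t) / w j"

lemma der_S:
  assumes t: "t \<in> {t0..<tB}"
  shows "(S has_real_derivative 1 / P j t) (at t)"
proof -
  have "((\<lambda>t. u j t / u 1 t) has_real_derivative w j / (u 1 t)\<^sup>2) (at t)"
    using der_ratio[OF n1 j late[OF t]] at_late[OF t] by (simp add: w_def)
  then have "(S has_real_derivative (w j / (u 1 t)\<^sup>2) / (u j t / u 1 t) / w j) (at t)"
    unfolding S_def[abs_def] by (intro DERIV_cdivide DERIV_ln_divide[THEN DERIV_chain2, THEN DERIV_cong]) auto
  moreover have "(w j / (u 1 t)\<^sup>2) / (u j t / u 1 t) / w j = 1 / P j t"
    using w_pos by (simp add: P_def power2_eq_square field_simps)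
  ultimately show ?thesis by simp
qed

lemma S_lim: "filterlim S at_top (at_left tB)"
proof -
  have "filterlim (\<lambda>t. (1 / w j) * ln (u j t / u 1 t)) at_top (at_left tB)"
    by (rule filterlim_tendsto_pos_mult_at_top[OF tendsto_const _ filterlim_compose[OF ln_at_top ratio_lim]])
      (use w_pos in simp)
  then show ?thesis by (simp add: S_def[abs_def])
qed

definition p :: "real \<Rightarrow> real" where "p t = v 1 t * v j t"

lemma p_pos: "t \<in> {t0..<tB} \<Longrightarrow> 0 < p t" using v_pos by (simp add: p_def)

lemma P_eq_p: "t \<in> {t0..<tB} \<Longrightarrow> P j t = p t * (\<phi> t)\<^sup>2"
  by (simp add: P_def p_def u_eq_v power2_eq_square)

lemma der_p:
  assumes t: "t \<in> {t0..<tB}"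
  shows "(p has_real_derivative (w j - 2 * \<beta> j t) / (\<phi> t)\<^sup>2) (at t)"
proof -
  have "(p has_real_derivative V 1 t / (\<phi> t)\<^sup>2 * v j t + V j t / (\<phi> t)\<^sup>2 * v 1 t) (at t)"
    unfolding p_def[abs_def] by (intro DERIV_mult der_v n1 j t)
  moreover have "V 1 t / (\<phi> t)\<^sup>2 * v j t + V j t / (\<phi> t)\<^sup>2 * v 1 t = ((w j - \<beta> j t) - \<beta> j t) / (\<phi> t)\<^sup>2"
    unfolding wronskian_v[OF j t] by (simp add: \<beta>_def diff_divide_distrib add_divide_distrib mult_ac)
  ultimately show ?thesis by simp
qed

text \<open>The derivative is bounded because \<open>0 \<le> \<beta> j \<le> w j\<close>, so a limit
  exists. If it were positive, \<open>1 / P j\<close> would be bounded near \<open>tB\<close> and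
  \<open>S\<close> would stay bounded over the remaining finite time.\<close>

lemma p_lim: "(p \<longlongrightarrow> 0) (at_left tB)"
proof -
  have "\<exists>L. (p \<longlongrightarrow> L) (at_left tB)"
  proof (rule bounded_deriv_tendsto_at_left[OF t1_less])
    fix t assume t: "t1 \<le> t" "t < tB"
    show "(p has_real_derivative (w j - 2 * \<beta> j t) / (\<phi> t)\<^sup>2) (at t within {t1..<tB})"
      using der_p[OF late1[OF t]] by (rule has_field_derivative_at_within)
    have "\<bar>w j - 2 * \<beta> j t\<bar> \<le> w j" using \<beta>_le[OF t] \<beta>_nonneg[OF late1[OF t], of j] by auto
    then show "\<bar>(w j - 2 * \<beta> j t) / (\<phi> t)\<^sup>2\<bar> \<le> w j / (cos 1)\<^sup>2"
      using \<phi>_bounds[OF late1[OF t]] cos1_pos w_pos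
      by (auto simp: abs_divide intro!: frac_le power_mono)
  qed
  then obtain L where L: "(p \<longlongrightarrow> L) (at_left tB)" by blast
  have "0 \<le> L"
    by (rule tendsto_lowerbound[OF L])
      (use eventually_late[OF t0(2)] in \<open>auto elim!: eventually_mono intro: less_imp_le[OF p_pos]\<close>)
  moreover have "\<not> 0 < L"
  proof
    assume "0 < L"
    have "((\<lambda>t. p t * (\<phi> t)\<^sup>2) \<longlongrightarrow> L * 1\<^sup>2) (at_left tB)" by (intro tendsto_intros L \<phi>_lim)
    then have "\<forall>\<^sub>F t in at_left tB. L / 2 < p t * (\<phi> t)\<^sup>2"
      by (rule order_tendstoD(1)) (use \<open>0 < L\<close> in simp)
    then obtain b where b: "b < tB" "\<And>t. b < t \<Longrightarrow> t < tB \<Longrightarrow> L / 2 < p t * (\<phi> t)\<^sup>2"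
      unfolding eventually_at_left_field by auto
    define t2 where "t2 = max t1 ((b + tB) / 2)"
    have t2: "t1 \<le> t2" "b < t2" "t2 < tB" using b t1_less by (auto simp: t2_def less_max_iff_disj)
    have "S t \<le> S t2 + 2 / L * (tB - t2)" if t: "t2 \<le> t" "t < tB" for t
    proof -
      have "S t - S t2 \<le> 2 / L * (t - t2)"
      proof (rule diff_le_deriv_bound[OF _ has_field_derivative_at_within[OF der_S]])
        fix x assume x: "t2 \<le> x" "x \<le> t"
        then show l: "x \<in> {t0..<tB}" using t t2 late1 by auto
        have "L / 2 \<le> P j x" unfolding P_eq_p[OF l] using b(2)[of x] x t t2 by simp
        then show "1 / P j x \<le> 2 / L" using \<open>0 < L\<close> frac_le[of 1 1 "L / 2" "P j x"] by simp
      qed (use t in auto)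
      also have "\<dots> \<le> 2 / L * (tB - t2)" using \<open>0 < L\<close> t by (intro mult_left_mono) auto
      finally show ?thesis by simp
    qed
    then have "\<forall>\<^sub>F t in at_left tB. S t \<le> S t2 + 2 / L * (tB - t2)"
      using eventually_late[OF t2(3)] by (auto elim!: eventually_mono)
    moreover have "\<forall>\<^sub>F t in at_left tB. S t2 + 2 / L * (tB - t2) + 1 \<le> S t"
      using S_lim by (simp add: filterlim_at_top)
    ultimately have "\<forall>\<^sub>F t in at_left tB. False" by eventually_elim auto
    then show False by simp
  qed
  ultimately show ?thesis using L by simp
qed

lemma P_lim: "(P j \<longlongrightarrow> 0) (at_left tB)"
proof (rule Lim_transform_eventually)
  have "((\<lambda>t. p t * (\<phi> t)\<^sup>2) \<longlongrightarrow> 0 * 1\<^sup>2) (at_left tB)" by (intro tendsto_intros p_lim \<phi>_lim)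
  then show "((\<lambda>t. p t * (\<phi> t)\<^sup>2) \<longlongrightarrow> 0) (at_left tB)" by simp
  show "\<forall>\<^sub>F t in at_left tB. p t * (\<phi> t)\<^sup>2 = P j t"
    using eventually_late[OF t0(2)] by eventually_elim (simp add: P_eq_p)
qed

text \<open>A limit below \<open>w j / 2\<close> would make the derivative of \<open>p\<close>
  nonnegative near \<open>tB\<close>, but a positive nondecreasing function cannot tend to
  0.\<close>

lemma \<beta>_limit_ge:
  assumes L: "(\<beta> j \<longlongrightarrow> L) (at_left tB)"
  shows "w j \<le> 2 * L"
proof (rule ccontr)
  assume "\<not> w j \<le> 2 * L"
  then have "\<forall>\<^sub>F t in at_left tB. \<beta> j t < w j / 2" by (intro order_tendstoD(2)[OF L]) auto
  then obtain b where b: "b < tB" "\<And>t. b < t \<Longrightarrow> t < tB \<Longrightarrow> \<beta> j t < w j / 2"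
    unfolding eventually_at_left_field by auto
  define t2 where "t2 = max t1 ((b + tB) / 2)"
  have t2: "t1 \<le> t2" "b < t2" "t2 < tB" using b t1_less by (auto simp: t2_def less_max_iff_disj)
  have "p t2 \<le> p t" if t: "t2 \<le> t" "t < tB" for t
  proof -
    have "0 * (t - t2) \<le> p t - p t2"
    proof (rule diff_ge_deriv_bound[OF _ has_field_derivative_at_within[OF der_p]])
      fix x assume x: "t2 \<le> x" "x \<le> t"
      then show "x \<in> {t0..<tB}" using t t2 late1 by auto
      show "0 \<le> (w j - 2 * \<beta> j x) / (\<phi> x)\<^sup>2" using b(2)[of x] x t t2 by simp
    qed (use t in auto)
    then show ?thesis by simp
  qed
  then have "\<forall>\<^sub>F t in at_left tB. p t2 \<le> p t"
    using eventually_late[OF t2(3)] by (auto elim!: eventually_mono)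
  then have "p t2 \<le> 0" by (intro tendsto_lowerbound[OF p_lim]) auto
  then show False using p_pos[OF late1[OF t2(1,3)]] by simp
qed

text \<open>The new time in the form used below: the divisor \<open>P j\<close> in the third clause
  cancels against the derivative of \<open>\<sigma>\<close>, and the last clause carries limits back
  to \<open>tB\<close> through \<open>S\<close>.\<close>

lemma time_changed:
  "\<exists>\<sigma> s0. filterlim \<sigma> (at_left tB) at_top \<and> (\<forall>s\<ge>s0. t1 \<le> \<sigma> s \<and> \<sigma> s < tB) \<and>
    (\<forall>f f' s. s0 \<le> s \<longrightarrow> (f has_real_derivative f' / P j (\<sigma> s)) (at (\<sigma> s)) \<longrightarrow>
      ((\<lambda>s. f (\<sigma> s)) has_real_derivative f') (at s)) \<and>
    (\<forall>(f :: real \<Rightarrow> real) L. ((\<lambda>s. f (\<sigma> s)) \<longlongrightarrow> L) at_top \<longrightarrow> (f \<longlongrightarrow> L) (at_left tB))"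
proof -
  obtain \<sigma> where \<sigma>S: "\<And>t. t1 \<le> t \<Longrightarrow> t < tB \<Longrightarrow> \<sigma> (S t) = t"
    and \<sigma>: "\<And>s. S t1 < s \<Longrightarrow> t1 < \<sigma> s \<and> \<sigma> s < tB \<and> (\<sigma> has_real_derivative P j (\<sigma> s)) (at s)"
    and lim: "filterlim \<sigma> (at_left tB) at_top"
    using time_change[OF t1_less der_S[OF late1] P_pos S_lim] by blast
  have "((\<lambda>s. f (\<sigma> s)) has_real_derivative f') (at s)"
    if "S t1 + 1 \<le> s" and f: "(f has_real_derivative f' / P j (\<sigma> s)) (at (\<sigma> s))" for f f' s
  proof -
    have d: "(\<sigma> has_real_derivative P j (\<sigma> s)) (at s)" using \<sigma>[of s] that by simp
    show ?thesis
      by (rule DERIV_cong[OF DERIV_chain2[where f = f and g = \<sigma>, OF f d]]) (simp add: P_pos less_imp_neq[symmetric])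
  qed
  moreover have "(f \<longlongrightarrow> L) (at_left tB)" if "((\<lambda>s. f (\<sigma> s)) \<longlongrightarrow> L) at_top"
    for f :: "real \<Rightarrow> real" and L
  proof (rule Lim_transform_eventually[OF filterlim_compose[OF that S_lim]])
    show "\<forall>\<^sub>F t in at_left tB. f (\<sigma> (S t)) = f t"
      using eventually_late[OF t1_less] by eventually_elim (simp add: \<sigma>S)
  qed
  moreover have "t1 \<le> \<sigma> s \<and> \<sigma> s < tB" if "S t1 + 1 \<le> s" for s
    using \<sigma>[of s] that by auto
  ultimately show ?thesis using lim by (intro exI[of _ \<sigma>] exI[of _ "S t1 + 1"]) blast
qed

lemma \<beta>_convergent_if_F_convergent:
  assumes F: "(F j \<longlongrightarrow> F0) (at_left tB)"
  shows "\<exists>L. (\<beta> j \<longlongrightarrow> L) (at_left tB) \<and> L \<le> w j"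
proof -
  obtain \<sigma> s0 where lim: "filterlim \<sigma> (at_left tB) at_top"
    and \<sigma>: "\<And>s. s0 \<le> s \<Longrightarrow> t1 \<le> \<sigma> s" "\<And>s. s0 \<le> s \<Longrightarrow> \<sigma> s < tB"
    and der: "\<And>f f' s. s0 \<le> s \<Longrightarrow> (f has_real_derivative f' / P j (\<sigma> s)) (at (\<sigma> s)) \<Longrightarrow>
      ((\<lambda>s. f (\<sigma> s)) has_real_derivative f') (at s)"
    and pull: "\<And>f L. ((\<lambda>s. f (\<sigma> s)) \<longlongrightarrow> (L :: real)) at_top \<Longrightarrow> (f \<longlongrightarrow> L) (at_left tB)"
    using time_changed by blast
  have "\<exists>L. ((\<lambda>s. \<beta> j (\<sigma> s)) \<longlongrightarrow> L) at_top \<and> 0 \<le> L \<and> L \<le> w j"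
    by (rule forced_logistic_convergent[of s0 "\<lambda>s. \<beta> j (\<sigma> s)" "w j" "\<lambda>s. F j (\<sigma> s)"])
      (use \<sigma> late1 in \<open>auto intro!: der der_\<beta>[OF j] \<beta>_nonneg \<beta>_le filterlim_compose[OF F lim]\<close>)
  then show ?thesis using pull by blast
qed

lemma F_not_at_top: "\<not> filterlim (F j) at_top (at_left tB)"
proof
  assume F: "filterlim (F j) at_top (at_left tB)"
  obtain \<sigma> s0 where lim: "filterlim \<sigma> (at_left tB) at_top"
    and \<sigma>: "\<And>s. s0 \<le> s \<Longrightarrow> t1 \<le> \<sigma> s" "\<And>s. s0 \<le> s \<Longrightarrow> \<sigma> s < tB"
    and der: "\<And>f f' s. s0 \<le> s \<Longrightarrow> (f has_real_derivative f' / P j (\<sigma> s)) (at (\<sigma> s)) \<Longrightarrow>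
      ((\<lambda>s. f (\<sigma> s)) has_real_derivative f') (at s)"
    using time_changed by blast
  have "\<not> filterlim (\<lambda>s. F j (\<sigma> s)) at_top at_top"
    by (rule forced_logistic_not_at_top[of s0 "\<lambda>s. \<beta> j (\<sigma> s)" "w j"])
      (use \<sigma> late1 in \<open>auto intro!: der der_\<beta>[OF j] \<beta>_nonneg \<beta>_le\<close>)
  then show False using filterlim_compose[OF F lim] by blast
qed

section \<open>The forcing as a product of powers of \<open>u 1\<close> and
  \<open>u j\<close>\<close>

definition \<theta> :: "real \<Rightarrow> real" where "\<theta> t = (\<Prod>i\<in>{j..n}. u j t / u i t)"

lemma high_index: "i \<in> {j..n} \<Longrightarrow> i \<in> {1..n}" using J by auto

lemma w_high: "i \<in> {j..n} \<Longrightarrow> w j \<le> w i" using high by (simp add: w_def)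

text \<open>The indices up to \<open>J\<close> share the initial value of \<open>lam 1\<close>, so
  their \<open>u i\<close> coincide with \<open>u 1\<close>; the remaining \<open>u i\<close> are
  compared with \<open>u j\<close>, and \<open>\<theta>\<close> collects the quotients.\<close>

lemma F_eq:
  assumes t: "t \<in> {t0..<tB}"
  shows "F j t = \<kappa> * rho0 * \<theta> t * ((u 1 t)\<^sup>2 * (u j t)\<^sup>2 / (u 1 t ^ J * u j t ^ (n - J)))"
proof -
  have "{1..n} = {1..J} \<union> {j..n}" "{1..J} \<inter> {j..n} = {}" using J by auto
  then have "(\<Prod>i=1..n. u i t) = (\<Prod>i\<in>{1..J}. u i t) * (\<Prod>i\<in>{j..n}. u i t)"
    by (simp add: prod.union_disjoint)
  also have "(\<Prod>i\<in>{1..J}. u i t) = (\<Prod>i\<in>{1..J}. u 1 t)"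
  proof (rule prod.cong[OF refl])
    fix i assume i: "i \<in> {1..J}"
    then have "i \<in> {1..n}" using J by auto
    then show "u i t = u 1 t" using u_mono[of i 1 t] u_mono[of 1 i t] n1 late[OF t] low[OF i] by simp
  qed
  also have "\<dots> = u 1 t ^ J" by simp
  finally have prod: "(\<Prod>i=1..n. u i t) = u 1 t ^ J * (\<Prod>i\<in>{j..n}. u i t)" .
  have "\<theta> t = u j t ^ (n - J) / (\<Prod>i\<in>{j..n}. u i t)"
    unfolding \<theta>_def using J by (simp add: prod_dividef)
  then have "(\<Prod>i\<in>{j..n}. u i t) = u j t ^ (n - J) / \<theta> t"
    using prod_u_pos[where A = "{j..n}" and t = t] by simp
  then show ?thesis
    unfolding F_def P_def rho_eq[OF late[OF t]] prod by (simp add: power_mult_distrib mult_ac)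
qed

lemma \<theta>_pos: "0 < \<theta> t" unfolding \<theta>_def by (intro prod_pos) simp

lemma \<theta>_le_1:
  assumes t: "t \<in> {t0..<tB}"
  shows "\<theta> t \<le> 1"
  unfolding \<theta>_def
proof (intro prod_le_1 conjI)
  fix i assume i: "i \<in> {j..n}"
  show "u j t / u i t \<le> 1" using u_mono[OF j high_index[OF i] late[OF t] high[OF i]] by simp
qed (simp add: less_imp_le)

text \<open>As \<open>w i \<ge> w j\<close>, the coefficient of \<open>u 1\<close> in the
  combination for \<open>u i\<close> is nonpositive, and dropping that term gives
  \<open>u i \<le> w i / w j * u j\<close>.\<close>

lemma \<theta>_ge:
  assumes t: "t \<in> {t0..<tB}"
  shows "(\<Prod>i\<in>{j..n}. w j / w i) \<le> \<theta> t"
  unfolding \<theta>_def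
proof (intro prod_mono conjI)
  fix i assume i: "i \<in> {j..n}"
  have wi: "w j \<le> w i" "0 < w i" using w_high[OF i] w_pos by auto
  then show "0 \<le> w j / w i" using w_pos by simp
  have "(1 - w i / w j) * u 1 t \<le> 0"
    using wi w_pos by (intro mult_nonpos_nonneg) (auto simp: less_imp_le)
  then have "u i t \<le> w i / w j * u j t"
    using u_combination[OF high_index[OF i] j w_pos late[OF t]] by linarith
  then show "w j / w i \<le> u j t / u i t" using wi w_pos by (simp add: field_simps)
qed

lemma \<theta>_lim: "(\<theta> \<longlongrightarrow> (\<Prod>i\<in>{j..n}. w j / w i)) (at_left tB)"
  unfolding \<theta>_def[abs_def]
proof (rule tendsto_prod)
  fix i assume i: "i \<in> {j..n}"
  have wi: "0 < w i" using w_high[OF i] w_pos by auto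
  have "((\<lambda>t. inverse (u j t / u 1 t)) \<longlongrightarrow> 0) (at_left tB)"
    using ratio_lim by (rule tendsto_inverse_0_at_top)
  then have "((\<lambda>t. inverse ((1 - w i / w j) * inverse (u j t / u 1 t) + w i / w j)) \<longlongrightarrow>
      inverse ((1 - w i / w j) * 0 + w i / w j)) (at_left tB)"
    by (intro tendsto_intros) (use wi w_pos in auto)
  moreover have "\<forall>\<^sub>F t in at_left tB.
      inverse ((1 - w i / w j) * inverse (u j t / u 1 t) + w i / w j) = u j t / u i t"
    using eventually_late[OF t0(2)]
  proof eventually_elim
    case (elim t)
    have "(1 - w i / w j) * inverse (u j t / u 1 t) + w i / w j
        = ((1 - w i / w j) * u 1 t + w i / w j * u j t) / u j t"
      by (simp add: add_divide_distrib)
    also have "\<dots> = u i t / u j t"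
      using u_combination[OF high_index[OF i] j w_pos late, of t] elim by simp
    finally show ?case by simp
  qed
  ultimately show "((\<lambda>t. u j t / u i t) \<longlongrightarrow> w j / w i) (at_left tB)"
    using Lim_transform_eventually by fastforce
qed

definition \<theta>0 :: real where "\<theta>0 = (\<Prod>i\<in>{j..n}. w j / w i)"

lemma \<theta>0_pos: "0 < \<theta>0"
  unfolding \<theta>0_def
proof (intro prod_pos)
  fix i assume "i \<in> {j..n}"
  then show "0 < w j / w i" using w_high[of i] w_pos by auto
qed

lemma eventually_F_eq:
  assumes "\<And>t. t1 \<le> t \<Longrightarrow> t < tB \<Longrightarrow> \<kappa> * rho0 * \<theta> t * ((u 1 t)\<^sup>2 * (u j t)\<^sup>2 / (u 1 t ^ J * u j t ^ (n - J))) = f t"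
  shows "\<forall>\<^sub>F t in at_left tB. f t = F j t"
  using eventually_late[OF t1_less] by eventually_elim (use F_eq assms in auto)

text \<open>\<open>v j\<close> is nondecreasing but may be unbounded; its reciprocal converges in
  either case.\<close>

lemma inverse_uj_lim: "\<exists>L. ((\<lambda>t. 1 / u j t) \<longlongrightarrow> L) (at_left tB)"
proof -
  have "\<exists>L. ((\<lambda>t. 1 / v j t) \<longlongrightarrow> L) (at_left tB) \<and> (\<forall>t\<in>{t1..<tB}. L \<le> 1 / v j t)"
  proof (rule antimono_tendsto_at_left[OF t1_less])
    show "1 / v j y \<le> 1 / v j x" if "t1 \<le> x" "x \<le> y" "y < tB" for x y
      using vj_mono[OF that] v_pos[OF late1, of x j] that by (intro divide_left_mono) auto
    show "0 \<le> 1 / v j x" if "t1 \<le> x" "x < tB" for x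
      using v_pos[OF late1[OF that], of j] by simp
  qed
  then obtain L where L: "((\<lambda>t. 1 / v j t) \<longlongrightarrow> L) (at_left tB)" by blast
  have "((\<lambda>t. 1 / v j t / \<phi> t) \<longlongrightarrow> L / 1) (at_left tB)"
    by (intro tendsto_divide L \<phi>_lim) simp
  moreover have "\<forall>\<^sub>F t in at_left tB. 1 / v j t / \<phi> t = 1 / u j t"
    using eventually_late[OF t0(2)] by eventually_elim (simp add: u_eq_v)
  ultimately have "((\<lambda>t. 1 / u j t) \<longlongrightarrow> L / 1) (at_left tB)" by (rule Lim_transform_eventually)
  then show ?thesis by blast
qed

text \<open>One factor \<open>u 1\<close> survives in the forcing, which tends to 0: for
  \<open>n = 2\<close> it comes with one \<open>u j\<close> and forms \<open>P j\<close>, and for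
  \<open>n \<ge> 3\<close> the remaining powers of \<open>1 / u j\<close> are bounded by those of
  \<open>1 / c1\<close>.\<close>

lemma \<beta>_convergent_J1:
  assumes "J = 1"
  shows "\<exists>L. (\<beta> j \<longlongrightarrow> L) (at_left tB) \<and> L \<le> w j"
proof (rule \<beta>_convergent_if_F_convergent)
  show "(F j \<longlongrightarrow> 0) (at_left tB)"
  proof (cases "n - J = 1")
    case True
    have "((\<lambda>t. \<kappa> * rho0 * \<theta> t * P j t) \<longlongrightarrow> \<kappa> * rho0 * \<theta>0 * 0) (at_left tB)"
      unfolding \<theta>0_def by (intro tendsto_intros \<theta>_lim P_lim)
    then have "((\<lambda>t. \<kappa> * rho0 * \<theta> t * P j t) \<longlongrightarrow> 0) (at_left tB)" by simp
    moreover have "\<forall>\<^sub>F t in at_left tB. \<kappa> * rho0 * \<theta> t * P j t = F j t"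
      by (rule eventually_F_eq) (unfold True, simp add: \<open>J = 1\<close> P_def power2_eq_square)
    ultimately show ?thesis by (rule Lim_transform_eventually)
  next
    case False
    then have "2 \<le> n - J" using J by simp
    then obtain q where q: "n - J = q + 2" by (metis le_add_diff_inverse2)
    show ?thesis
    proof (rule Lim_null_comparison)
      have "((\<lambda>t. \<kappa> * rho0 * 1 * u 1 t * (1 / c1) ^ q) \<longlongrightarrow> \<kappa> * rho0 * 1 * 0 * (1 / c1) ^ q) (at_left tB)"
        by (intro tendsto_intros u1_lim)
      then show "((\<lambda>t. \<kappa> * rho0 * 1 * u 1 t * (1 / c1) ^ q) \<longlongrightarrow> 0) (at_left tB)" by simp
      show "\<forall>\<^sub>F t in at_left tB. norm (F j t) \<le> \<kappa> * rho0 * 1 * u 1 t * (1 / c1) ^ q"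
        using eventually_late[OF t1_less]
      proof eventually_elim
        case (elim t)
        then have t: "t \<in> {t0..<tB}" by simp
        have "F j t = \<kappa> * rho0 * \<theta> t * u 1 t * (1 / u j t) ^ q"
          unfolding F_eq[OF t] q unfolding \<open>J = 1\<close> by (simp add: power_add power2_eq_square field_simps)
        moreover have "\<dots> \<le> \<kappa> * rho0 * 1 * u 1 t * (1 / c1) ^ q"
          using \<kappa>_pos rho0 \<theta>_le_1[OF t] \<theta>_pos[of t] uj_ge[of t] elim c1_pos less_imp_le[OF u_pos]
          by (intro mult_mono power_mono frac_le) (auto intro!: mult_nonneg_nonneg)
        moreover have "0 \<le> F j t" using \<kappa>_pos rho_pos[OF late[OF t]] by (simp add: F_def)
        ultimately show ?case by simp
      qed
    qed
  qed
qed

text \<open>The powers of \<open>u 1\<close> cancel. For \<open>n = 3\<close> the forcing is a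
  convergent factor times the monotone \<open>v j\<close>, and divergence is excluded by
  \<open>F_not_at_top\<close>; for \<open>n \<ge> 4\<close> it is a convergent factor times a power
  of \<open>1 / u j\<close>.\<close>

lemma \<beta>_convergent_J2:
  assumes "J = 2"
  shows "\<exists>L. (\<beta> j \<longlongrightarrow> L) (at_left tB) \<and> L \<le> w j"
proof (cases "n - J = 1")
  case True
  have F: "\<forall>\<^sub>F t in at_left tB. \<kappa> * rho0 * \<theta> t * \<phi> t * v j t = F j t"
  proof (rule eventually_F_eq)
    fix t assume "t1 \<le> t" "t < tB"
    then have "u j t = v j t * \<phi> t" using u_eq_v late1 by blast
    then show "\<kappa> * rho0 * \<theta> t * ((u 1 t)\<^sup>2 * (u j t)\<^sup>2 / (u 1 t ^ J * u j t ^ (n - J)))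
        = \<kappa> * rho0 * \<theta> t * \<phi> t * v j t"
      unfolding True unfolding \<open>J = 2\<close> using u_neq0[of j t] by (simp add: power2_eq_square)
  qed
  have lim: "((\<lambda>t. \<kappa> * rho0 * \<theta> t * \<phi> t) \<longlongrightarrow> \<kappa> * rho0 * \<theta>0 * 1) (at_left tB)"
    unfolding \<theta>0_def by (intro tendsto_intros \<theta>_lim \<phi>_lim)
  have "(\<exists>L. (v j \<longlongrightarrow> L) (at_left tB)) \<or> filterlim (v j) at_top (at_left tB)"
    using t1_less vj_mono by (rule mono_at_left_cases)
  then show ?thesis
  proof
    assume "\<exists>L. (v j \<longlongrightarrow> L) (at_left tB)"
    then obtain L where "(v j \<longlongrightarrow> L) (at_left tB)" by blast
    from Lim_transform_eventually[OF tendsto_mult[OF lim this] F]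
    show ?thesis by (rule \<beta>_convergent_if_F_convergent)
  next
    assume "filterlim (v j) at_top (at_left tB)"
    then have "filterlim (\<lambda>t. \<kappa> * rho0 * \<theta> t * \<phi> t * v j t) at_top (at_left tB)"
      by (rule filterlim_tendsto_pos_mult_at_top[OF lim, rotated]) (use \<kappa>_pos rho0 \<theta>0_pos in simp)
    then have "filterlim (F j) at_top (at_left tB)"
      using filterlim_cong[OF refl refl F] by simp
    then show ?thesis using F_not_at_top by simp
  qed
next
  case False
  then have "2 \<le> n - J" using J by simp
  then obtain q where q: "n - J = q + 2" by (metis le_add_diff_inverse2)
  obtain L where "((\<lambda>t. 1 / u j t) \<longlongrightarrow> L) (at_left tB)" using inverse_uj_lim by blast
  then have "((\<lambda>t. \<kappa> * rho0 * \<theta> t * (1 / u j t) ^ q) \<longlongrightarrow> \<kappa> * rho0 * \<theta>0 * L ^ q) (at_left tB)"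
    unfolding \<theta>0_def by (intro tendsto_intros \<theta>_lim)
  then have "(F j \<longlongrightarrow> \<kappa> * rho0 * \<theta>0 * L ^ q) (at_left tB)"
    by (rule Lim_transform_eventually[OF _ eventually_F_eq])
      (unfold q, unfold \<open>J = 2\<close>, simp add: power_add power2_eq_square field_simps)
  then show ?thesis by (rule \<beta>_convergent_if_F_convergent)
qed

text \<open>With \<open>J = q + 3\<close> and \<open>J = m + r\<close> the forcing is
  \<open>\<kappa> * rho0 * \<theta> * u j ^ r / P j ^ (q + 1)\<close>. Its numerator is bounded away
  from 0 and \<open>P j\<close> tends to 0, so it would diverge.\<close>

lemma many_low_impossible:
  assumes "3 \<le> J" "n - J \<le> J"
  shows False
proof -
  obtain q where q: "J = q + 3" using \<open>3 \<le> J\<close> by (metis le_add_diff_inverse2)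
  define m where "m = n - J"
  obtain r where r: "J = m + r" using \<open>n - J \<le> J\<close> unfolding m_def by (metis le_add_diff_inverse)
  have "filterlim (F j) at_top (at_left tB)"
  proof (rule filterlim_at_top_mono)
    have "filterlim (\<lambda>t. inverse (P j t)) at_top (at_left tB)"
      by (rule filterlim_inverse_at_top[OF P_lim]) (simp add: P_pos)
    then have "filterlim (\<lambda>t. inverse (P j t) ^ (q + 1)) at_top (at_left tB)"
      by (intro filterlim_pow_at_top) auto
    then show "filterlim (\<lambda>t. \<kappa> * rho0 * \<theta>0 * c1 ^ r * inverse (P j t) ^ (q + 1)) at_top (at_left tB)"
      by (rule filterlim_tendsto_pos_mult_at_top[OF tendsto_const, rotated])
        (use \<kappa>_pos rho0 \<theta>0_pos c1_pos in simp)
    show "\<forall>\<^sub>F t in at_left tB. \<kappa> * rho0 * \<theta>0 * c1 ^ r * inverse (P j t) ^ (q + 1) \<le> F j t"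
      using eventually_late[OF t1_less]
    proof eventually_elim
      case (elim t)
      then have t: "t \<in> {t0..<tB}" by simp
      have "u j t ^ m * u j t ^ r = u j t ^ (q + 1) * (u j t)\<^sup>2"
        using q r by (simp flip: power_add) (simp add: numeral_3_eq_3 numeral_2_eq_2)
      moreover have "u 1 t ^ J = u 1 t ^ (q + 1) * (u 1 t)\<^sup>2"
        using q by (simp flip: power_add) (simp add: numeral_3_eq_3 numeral_2_eq_2)
      ultimately have "F j t = \<kappa> * rho0 * \<theta> t * u j t ^ r * inverse (P j t) ^ (q + 1)"
        unfolding F_eq[OF t] m_def[symmetric] P_def
        by (simp add: power_mult_distrib field_simps del: power_Suc)
      moreover have "\<kappa> * rho0 * \<theta>0 * c1 ^ r * inverse (P j t) ^ (q + 1) \<le> \<dots>"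
        using \<kappa>_pos rho0 \<theta>_ge[OF t, folded \<theta>0_def] \<theta>_pos[of t] \<theta>0_pos uj_ge[of t] elim c1_pos
          less_imp_le[OF P_pos]
        by (intro mult_mono power_mono mult_nonneg_nonneg zero_le_power) auto
      ultimately show ?case by simp
    qed
  qed
  then show False using F_not_at_top by simp
qed

text \<open>Here the forcing contains a growing power of \<open>u 1\<close> and a possibly decaying
  power of \<open>u j\<close>, so its limit is not evident. It is written as a decreasing factor
  times a power of a weight \<open>M\<close>, to which \<open>lotka_volterra_convergent\<close>
  applies.\<close>

lemma \<beta>_convergent_few_low:
  assumes "3 \<le> J" "J < n - J"
  shows "\<exists>L. (\<beta> j \<longlongrightarrow> L) (at_left tB) \<and> L \<le> w j"
proof -
  define m where "m = n - J"
  have mJ: "real J < real m" "3 \<le> real J" using assms by (auto simp: m_def)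
  \<comment> \<open>\<open>N\<close> and \<open>D\<close> come from matching exponents: with
    \<open>M = (\<phi>^2 / P j) * (u 1 / u j) powr D\<close>, the power
    \<open>M powr (N / 2)\<close> contains \<open>u 1\<close> to the power \<open>2 - J\<close> and
    \<open>u j\<close> to the power \<open>2 - m\<close>.\<close>
  define N where "N = real m + real J - 4"
  have N: "0 < N" using mJ by (simp add: N_def)
  define D where "D = (real m - real J) / N"
  have D: "0 < D" using mJ N by (simp add: D_def)
  have ND: "N * D = real m - real J" using N by (simp add: D_def)
  \<comment> \<open>The relative growth rate of \<open>M\<close> in the new time is
    \<open>2 * \<beta> j - w j * (1 + D)\<close>, which vanishes at \<open>\<beta> j = b\<close>.
    Since \<open>D > 0\<close>, \<open>b\<close> exceeds \<open>w j / 2\<close>, the dissipative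
    case.\<close>
  define b where "b = w j * (1 + D) / 2"
  define l where "l i t = integral {0..t} (lam i)" for i t
  have ul: "u i t = exp (l i t)" for i t by (simp add: l_def u_fun_def)
  have dl: "(l i has_real_derivative lam i t) (at t)" if "i \<in> {1..n}" "t \<in> {t0..<tB}" for i t
    unfolding l_def[abs_def] using der_integral_lam[OF that(1) late[OF that(2)]] at_late[OF that(2)] by simp
  have dln: "((\<lambda>t. ln (\<phi> t)) has_real_derivative \<psi> t / \<phi> t) (at t)" if "t \<in> {t0..<tB}" for t
    using DERIV_ln_divide[THEN DERIV_chain2, OF \<phi>_bounds(2)[OF that] der_\<phi>] by simp
  define M where "M t = exp (- (l 1 t + l j t - 2 * ln (\<phi> t)) - D * (l j t - l 1 t))" for t
  \<comment> \<open>The factor \<open>\<phi> powr (- N)\<close> compensates the powers of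
    \<open>\<phi>\<close> in \<open>M\<close>. \<open>\<Theta>\<close> decreases since
    \<open>\<phi>\<close> increases and the \<open>u i\<close> with \<open>i \<ge> j\<close> grow at
    least at the rate of \<open>u j\<close>; it stays above a positive constant since
    \<open>\<phi> \<le> 1\<close> and \<open>\<theta> \<ge> \<theta>0\<close>.\<close>
  define \<Theta> where "\<Theta> t = \<kappa> * rho0 * exp ((\<Sum>i\<in>{j..n}. l j t - l i t) - N * ln (\<phi> t))" for t
  have dM: "(M has_real_derivative (2 * (\<beta> j t - b) * M t) / P j t) (at t)" if t: "t \<in> {t0..<tB}" for t
  proof (rule DERIV_cong)
    show "(M has_real_derivative M t *
        (- (lam 1 t + lam j t - 2 * (\<psi> t / \<phi> t)) - D * (lam j t - lam 1 t))) (at t)"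
      unfolding M_def[abs_def] by (rule derivative_eq_intros dl[OF n1 t] dl[OF j t] dln[OF t] refl)+ simp
    have "P j t * (- (lam 1 t + lam j t - 2 * (\<psi> t / \<phi> t)) - D * (lam j t - lam 1 t))
        = - (P j t * (lam 1 t + lam j t - 2 * (\<psi> t / \<phi> t))) - D * (P j t * (lam j t - lam 1 t))"
      by (simp add: algebra_simps)
    also have "\<dots> = 2 * (\<beta> j t - b)"
      unfolding P_lam_sum[OF j t] P_lam_diff[OF j t] by (simp add: b_def field_simps)
    finally have "- (lam 1 t + lam j t - 2 * (\<psi> t / \<phi> t)) - D * (lam j t - lam 1 t)
        = 2 * (\<beta> j t - b) / P j t"
      using P_pos[of j t] by (simp add: eq_divide_eq mult.commute)
    then show "M t * (- (lam 1 t + lam j t - 2 * (\<psi> t / \<phi> t)) - D * (lam j t - lam 1 t))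
        = (2 * (\<beta> j t - b) * M t) / P j t" by simp
  qed
  define \<Theta>' where "\<Theta>' t = \<Theta> t * ((\<Sum>i\<in>{j..n}. lam j t - lam i t) - N * (\<psi> t / \<phi> t))" for t
  have d\<Theta>: "(\<Theta> has_real_derivative \<Theta>' t) (at t)" if t: "t \<in> {t0..<tB}" for t
  proof -
    have dsum: "((\<lambda>t. \<Sum>i\<in>{j..n}. l j t - l i t) has_real_derivative (\<Sum>i\<in>{j..n}. lam j t - lam i t)) (at t)"
      by (intro DERIV_sum DERIV_diff dl t j high_index)
    show ?thesis
      unfolding \<Theta>_def[abs_def] \<Theta>'_def by (rule dsum dln[OF t] derivative_eq_intros refl)+ simp
  qed
  have \<Theta>_pos: "0 < \<Theta> t" for t using \<kappa>_pos rho0 by (simp add: \<Theta>_def)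
  have \<Theta>': "\<Theta>' t \<le> 0" if t: "t \<in> {t0..<tB}" for t
  proof -
    have "(\<Sum>i\<in>{j..n}. lam j t - lam i t) \<le> 0"
      by (intro sum_nonpos) (use lam_mono[OF j high_index late[OF t] high] in auto)
    moreover have "0 \<le> N * (\<psi> t / \<phi> t)" using N \<psi>_nonneg[OF t] \<phi>_bounds[OF t] by simp
    ultimately show ?thesis
      unfolding \<Theta>'_def using \<Theta>_pos[of t] by (intro mult_nonneg_nonpos) auto
  qed
  have \<theta>_exp: "\<theta> t = exp (\<Sum>i\<in>{j..n}. l j t - l i t)" for t
    by (simp add: \<theta>_def ul exp_sum exp_diff)
  have \<Theta>_ge: "\<kappa> * rho0 * \<theta>0 \<le> \<Theta> t" if t: "t \<in> {t0..<tB}" for t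
  proof -
    have "ln (\<phi> t) \<le> 0" using \<phi>_bounds[OF t] by simp
    then have "N * ln (\<phi> t) \<le> 0" using N by (simp add: mult_nonneg_nonpos)
    then have "exp (\<Sum>i\<in>{j..n}. l j t - l i t) \<le> exp ((\<Sum>i\<in>{j..n}. l j t - l i t) - N * ln (\<phi> t))"
      by simp
    then have "\<theta>0 \<le> exp ((\<Sum>i\<in>{j..n}. l j t - l i t) - N * ln (\<phi> t))"
      using \<theta>_ge[OF t] unfolding \<theta>0_def[symmetric] \<theta>_exp by linarith
    then show ?thesis unfolding \<Theta>_def using \<kappa>_pos rho0 by (intro mult_left_mono) auto
  qed
  have F: "F j t = \<Theta> t * M t powr (N / 2)" if t: "t \<in> {t0..<tB}" for t
  proof -
    have "(u 1 t)\<^sup>2 * (u j t)\<^sup>2 / (u 1 t ^ J * u j t ^ m)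
        = exp (2 * l 1 t + 2 * l j t - (real J * l 1 t + real m * l j t))"
      by (simp add: ul exp_add exp_diff exp_of_nat_mult exp_double)
    then have "F j t = \<kappa> * rho0 * exp ((\<Sum>i\<in>{j..n}. l j t - l i t) +
        (2 * l 1 t + 2 * l j t - (real J * l 1 t + real m * l j t)))"
      unfolding F_eq[OF t] m_def[symmetric] \<theta>_exp exp_add by simp
    also have "2 * l 1 t + 2 * l j t - (real J * l 1 t + real m * l j t) = - N * ln (\<phi> t)
        + N / 2 * (- (l 1 t + l j t - 2 * ln (\<phi> t)) - D * (l j t - l 1 t))"
    proof -
      have "N / 2 * (- (l 1 t + l j t - 2 * ln (\<phi> t)) - D * (l j t - l 1 t))
        = N * ln (\<phi> t) - N / 2 * (l 1 t + l j t) - (N * D) / 2 * (l j t - l 1 t)"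
        by (simp add: algebra_simps)
      also have "\<dots> = N * ln (\<phi> t) + (2 * l 1 t + 2 * l j t - (real J * l 1 t + real m * l j t))"
        unfolding ND unfolding N_def by (simp add: field_simps)
      finally show ?thesis by linarith
    qed
    also have "\<kappa> * rho0 * exp ((\<Sum>i\<in>{j..n}. l j t - l i t) + (- N * ln (\<phi> t)
        + N / 2 * (- (l 1 t + l j t - 2 * ln (\<phi> t)) - D * (l j t - l 1 t)))) = \<Theta> t * M t powr (N / 2)"
    proof -
      have M: "M t powr (N / 2) =
          exp (N / 2 * (- (l 1 t + l j t - 2 * ln (\<phi> t)) - D * (l j t - l 1 t)))"
        by (simp add: M_def powr_def)
      have "A + (- N * B + C) = (A - N * B) + C" for A B C :: real by simp
      then show ?thesis unfolding \<Theta>_def M mult.assoc exp_add[symmetric] by (simp only:)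
    qed
    finally show ?thesis .
  qed
  obtain \<sigma> s0 where \<sigma>: "\<And>s. s0 \<le> s \<Longrightarrow> t1 \<le> \<sigma> s" "\<And>s. s0 \<le> s \<Longrightarrow> \<sigma> s < tB"
    and der: "\<And>f f' s. s0 \<le> s \<Longrightarrow> (f has_real_derivative f' / P j (\<sigma> s)) (at (\<sigma> s)) \<Longrightarrow>
      ((\<lambda>s. f (\<sigma> s)) has_real_derivative f') (at s)"
    and pull: "\<And>f L. ((\<lambda>s. f (\<sigma> s)) \<longlongrightarrow> (L :: real)) at_top \<Longrightarrow> (f \<longlongrightarrow> L) (at_left tB)"
    using time_changed by blast
  have \<sigma>l: "\<sigma> s \<in> {t0..<tB}" if "s0 \<le> s" for s using \<sigma> late1 that by blast
  have "\<exists>L. ((\<lambda>s. \<beta> j (\<sigma> s)) \<longlongrightarrow> L) at_top \<and> 0 \<le> L \<and> L \<le> w j"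
  proof (rule lotka_volterra_convergent[where M = "\<lambda>s. M (\<sigma> s)" and \<theta> = "\<lambda>s. \<Theta> (\<sigma> s)"
        and \<theta>' = "\<lambda>s. P j (\<sigma> s) * \<Theta>' (\<sigma> s)" and b = b and a = "N / 2" and ?c0.0 = "\<kappa> * rho0 * \<theta>0" and ?s0.0 = s0])
    fix s assume s: "s0 \<le> s"
    show "((\<lambda>s. \<beta> j (\<sigma> s)) has_real_derivative
        \<beta> j (\<sigma> s) * (w j - \<beta> j (\<sigma> s)) - \<Theta> (\<sigma> s) * M (\<sigma> s) powr (N / 2)) (at s)"
      using der[OF s der_\<beta>[OF j \<sigma>l[OF s]]] F[OF \<sigma>l[OF s]] by simp
    show "((\<lambda>s. M (\<sigma> s)) has_real_derivative 2 * (\<beta> j (\<sigma> s) - b) * M (\<sigma> s)) (at s)"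
      by (rule der[OF s dM[OF \<sigma>l[OF s]]])
    show "((\<lambda>s. \<Theta> (\<sigma> s)) has_real_derivative P j (\<sigma> s) * \<Theta>' (\<sigma> s)) (at s)"
      by (rule der[OF s]) (use d\<Theta>[OF \<sigma>l[OF s]] P_pos[of j "\<sigma> s"] in simp)
    show "P j (\<sigma> s) * \<Theta>' (\<sigma> s) \<le> 0"
      using \<Theta>'[OF \<sigma>l[OF s]] P_pos[of j "\<sigma> s"] by (intro mult_nonneg_nonpos) auto
    show "\<kappa> * rho0 * \<theta>0 \<le> \<Theta> (\<sigma> s)" by (rule \<Theta>_ge[OF \<sigma>l[OF s]])
    show "0 \<le> \<beta> j (\<sigma> s) \<and> \<beta> j (\<sigma> s) \<le> w j"
      using \<beta>_nonneg[OF \<sigma>l[OF s]] \<beta>_le[OF \<sigma>[OF s]] by simp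
    show "0 < M (\<sigma> s)" by (simp add: M_def)
  next
    show "0 < \<kappa> * rho0 * \<theta>0" using \<kappa>_pos rho0 \<theta>0_pos by simp
    show "0 < N / 2" using N by simp
    show "w j < 2 * b" using D w_pos by (simp add: b_def algebra_simps)
  qed
  then show ?thesis using pull by blast
qed

lemma limits:
  "\<exists>L. (\<beta> j \<longlongrightarrow> L) (at_left tB) \<and> w j \<le> 2 * L \<and> L \<le> w j"
proof -
  have "J = 1 \<or> J = 2 \<or> (3 \<le> J \<and> n - J \<le> J) \<or> (3 \<le> J \<and> J < n - J)" using J by arith
  then have "\<exists>L. (\<beta> j \<longlongrightarrow> L) (at_left tB) \<and> L \<le> w j"
    by (elim disjE conjE) (fact \<beta>_convergent_J1 \<beta>_convergent_J2 \<beta>_convergent_few_low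
        | drule (1) many_low_impossible, erule FalseE)+
  then show ?thesis using \<beta>_limit_ge by blast
qed

end

section \<open>Passage from the index \<open>J + 1\<close> to an arbitrary larger index\<close>

theorem theorem3p7:
  fixes n J j :: nat and k cb rho0 tB :: real
    and lam0 :: "nat \<Rightarrow> real" and lam :: "nat \<Rightarrow> real \<Rightarrow> real" and rho :: "real \<Rightarrow> real"
  assumes "n \<ge> 2" and "k > 0" and "cb > 0" and "rho0 > 0"
    and "1 \<le> J" and "J \<le> n"
    and "\<forall>i\<in>{1..J}. lam0 i = lam0 1"
    and "J < n \<longrightarrow> lam0 J < lam0 (J + 1)"
    and "\<forall>i. J + 1 \<le> i \<and> i < n \<longrightarrow> lam0 i \<le> lam0 (i + 1)"
    and "0 < tB"
    and "maximal_solution n k cb rho0 lam0 tB lam rho"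
    and "J < j" and "j \<le> n"
  shows "\<exists>p q. 0 \<le> q \<and> q \<le> p \<and>
    ((\<lambda>t. deriv (u_fun lam 1) t * u_fun lam j t) \<longlongrightarrow> - p) (at_left tB) \<and>
    ((\<lambda>t. u_fun lam 1 t * deriv (u_fun lam j) t) \<longlongrightarrow> q) (at_left tB)"
proof -
  \<comment> \<open>Convergence is proved for the first index above the minimum only; the given
    \<open>j\<close> is reached by a linear combination.\<close>
  define h where "h = J + 1"
  have h: "h \<le> n" "h \<le> j" using assms(12,13) by (auto simp: h_def)
  have low: "lam0 i = lam0 1" if "i \<in> {1..J}" for i using assms(7) that by blast
  have high: "lam0 h \<le> lam0 i" if "i \<in> {h..n}" for i
  proof -
    have "h \<le> i" "i \<le> n" using that by auto
    then show ?thesis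
    proof (induction i rule: dec_induct)
      case (step i)
      then have "lam0 i \<le> lam0 (i + 1)" using assms(9) by (simp add: h_def)
      then show ?case using step by simp
    qed simp
  qed
  have gap: "lam0 1 < lam0 h" using assms(8) low[of J] h assms(5) by (simp add: h_def)
  interpret maximal_flow n k cb rho0 tB lam0 lam rho
  proof
    show "lam0 1 \<le> lam0 i" if "i \<in> {1..n}" for i
    proof (cases "i \<le> J")
      case True
      then show ?thesis using low[of i] that by simp
    next
      case False
      then show ?thesis using high[of i] gap that by (simp add: h_def)
    qed
  qed (fact assms)+
  have hn: "h \<in> {1..n}" and jn: "j \<in> {1..n}" using h assms(13) by (auto simp: h_def)
  have wh: "0 < w h" using gap by (simp add: w_def)
  have wj: "w h \<le> w j" using high[of j] h assms(13) by (simp add: w_def)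
  have "\<exists>L. (\<beta> h \<longlongrightarrow> L) (at_left tB) \<and> w h \<le> 2 * L \<and> L \<le> w h \<and> (P h \<longlongrightarrow> 0) (at_left tB)"
  proof (cases "\<exists>t1\<in>{t0..<tB}. 0 < V h t1")
    case True
    then obtain t1 where t1: "t1 \<in> {t0..<tB}" "0 < V h t1" by blast
    interpret expanding_pair n k cb rho0 tB lam0 lam rho J h t1
      by unfold_locales (fact assms(5) h_def h(1) low gap high t1)+
    show ?thesis using limits P_lim by blast
  next
    case False
    then have "V h t \<le> 0" if "t \<in> {t0..<tB}" for t using that by (auto simp: not_less)
    then show ?thesis using limits_if_V_nonpos[OF hn] wh by (intro exI[of _ "w h"]) auto
  qed
  then obtain L where L: "(\<beta> h \<longlongrightarrow> L) (at_left tB)" "w h \<le> 2 * L" "L \<le> w h"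
    and Ph: "(P h \<longlongrightarrow> 0) (at_left tB)" by blast
  \<comment> \<open>Since \<open>u j = (1 - r) * u 1 + r * u h\<close>, the product
    \<open>u 1' * u j\<close> tends to \<open>- (r * L)\<close>; the witnesses are
    \<open>p = r * L\<close> and \<open>q = w j - r * L\<close>.\<close>
  define r where "r = w j / w h"
  have r: "0 < r" "w j = r * w h" using wh wj by (auto simp: r_def)
  have "((\<lambda>t. (1 - r) * (lam 1 t * u 1 t * u 1 t) + r * (- \<beta> h t + P h t * (\<psi> t / \<phi> t)))
      \<longlongrightarrow> (1 - r) * 0 + r * (- L + 0 * (0 / 1))) (at_left tB)"
    by (intro tendsto_intros lam1_u1_sq_lim L Ph \<psi>_lim \<phi>_lim) simp
  moreover have "\<forall>\<^sub>F t in at_left tB.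
      (1 - r) * (lam 1 t * u 1 t * u 1 t) + r * (- \<beta> h t + P h t * (\<psi> t / \<phi> t)) = lam 1 t * u 1 t * u j t"
    using eventually_late[OF t0(2)]
  proof eventually_elim
    case (elim t)
    then have t: "t \<in> {t0..<tB}" by simp
    have "- \<beta> h t + P h t * (\<psi> t / \<phi> t) = lam 1 t * u 1 t * u h t"
      unfolding \<beta>_eq[OF t] by (simp add: P_def algebra_simps)
    moreover have "u j t = (1 - r) * u 1 t + r * u h t"
      using u_combination[OF jn hn wh late[OF t]] by (simp add: r_def)
    ultimately show ?case by algebra
  qed
  ultimately have main: "((\<lambda>t. lam 1 t * u 1 t * u j t) \<longlongrightarrow> - (r * L)) (at_left tB)"
    using Lim_transform_eventually by fastforce
  have der: "deriv (u i) t = lam i t * u i t" if "i \<in> {1..n}" "t \<in> {t0..<tB}" for i t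
    by (rule DERIV_imp_deriv[OF der_u_at[OF that]])
  have "((\<lambda>t. deriv (u 1) t * u j t) \<longlongrightarrow> - (r * L)) (at_left tB)"
    using main
  proof (rule Lim_transform_eventually)
    show "\<forall>\<^sub>F t in at_left tB. lam 1 t * u 1 t * u j t = deriv (u 1) t * u j t"
      using eventually_late[OF t0(2)]
    proof eventually_elim
      case (elim t)
      then show ?case using der[OF n1, of t] by simp
    qed
  qed
  \<comment> \<open>The constant Wronskian gives
    \<open>u 1 * u j' = w j + u 1' * u j\<close>.\<close>
  moreover have "((\<lambda>t. u 1 t * deriv (u j) t) \<longlongrightarrow> w j + - (r * L)) (at_left tB)"
    using tendsto_add[OF tendsto_const main]
  proof (rule Lim_transform_eventually)
    show "\<forall>\<^sub>F t in at_left tB. w j + lam 1 t * u 1 t * u j t = u 1 t * deriv (u j) t"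
      using eventually_late[OF t0(2)]
    proof eventually_elim
      case (elim t)
      then show ?case
        using P_lam_diff[OF jn, of t] by (simp add: der[OF jn] P_def algebra_simps)
    qed
  qed
  \<comment> \<open>Nonnegativity of \<open>q\<close> is \<open>L \<le> w h\<close>, and
    \<open>q \<le> p\<close> is \<open>w h \<le> 2 * L\<close>, both scaled by
    \<open>r\<close>.\<close>
  moreover have "0 \<le> w j + - (r * L)"
    using r L by (simp add: mult_left_mono)
  moreover have "w j + - (r * L) \<le> r * L"
    using mult_left_mono[OF L(2), of r] r by simp
  ultimately show ?thesis by blast
qed

end
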